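(* $$\frac{5+4\sqrt{2}}{7}\le \text{\ae}(4)\le \frac{3+6\sqrt{2}}{7}.$$
   Context: All Banach spaces are real; subsets of metric spaces carry the induced metric. For metric spaces $X\subset Y$, a Banach space $E$ and a Lipschitz map $f\colon X\to E$ with optimal Lipschitz constant $\mathrm{Lip}(f)$, let $e(X,Y,E,f)$ be the infimum of those $K\ge 0$ for which there is a $K\,\mathrm{Lip}(f)$-Lipschitz map $\bar f\colon Y\to E$ extending $f$. Put $\nu(X,Y):=\sup\{e(X,Y,E,f): E\text{ a Banach space}, f\colon X\to E\text{ Lipschitz}\}$, $\text{\ae}(X):=\sup\{\nu(X,Y): Y\supset X\text{ a metric space}\}$, and $\text{\ae}(n):=\sup\{\text{\ae}(X): X\text{ a metric space with }|X|=n\}$. *)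

theory Defs
  imports "HOL-Analysis.Analysis" "HOL-Algebra.Module"
begin

text \<open>
  Metric spaces are elements of the library type \<^typ>\<open>'a metric\<close> (a carrier inside \<open>'a\<close> together
  with a metric), and Banach spaces are vector spaces with a carrier inside a type \<open>'b\<close>, so that
  suprema over spaces are suprema over all structures carried by subsets of \<open>'a\<close> and \<open>'b\<close>.
  The supremum over the proper class of all metric and Banach spaces is rendered by leaving these
  two universes arbitrary, subject only to containing a copy of the reals. The value of
  \<open>ae\<close> at a finite cardinality does not depend on the choice of such universes: a Lipschitz map on a
  finite \<open>X\<close> extends linearly to the finite-dimensional Lipschitz-free space over \<open>X\<close>, and every
  metric space containing \<open>X\<close> admits a 1-Lipschitz map, isometric on \<open>X\<close>, into the space of
  real functions on \<open>X\<close> with the sup-norm.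
\<close>

definition real_field_ring :: "real ring" where
  "real_field_ring = \<lparr>carrier = UNIV, mult = (*), one = 1, zero = 0, add = (+)\<rparr>"

text \<open>
  The fields \<open>mult\<close> and \<open>one\<close> that a module record inherits from the ring record play no role.
  The locale \<^locale>\<open>Metric_space\<close> demands nonnegativity and symmetry of the metric also outside
  the carrier, hence the case distinction.
\<close>

definition norm_metric :: "(real, 'b) module \<Rightarrow> ('b \<Rightarrow> real) \<Rightarrow> 'b metric" where
  "norm_metric E N = metric (carrier E,
     \<lambda>u v. if u \<in> carrier E \<and> v \<in> carrier E then N (u \<ominus>\<^bsub>E\<^esub> v) else 0)"

definition Banach_space :: "(real, 'b) module \<Rightarrow> ('b \<Rightarrow> real) \<Rightarrow> bool" where
  "Banach_space E N \<longleftrightarrow>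
     Module.module real_field_ring E \<and>
     (\<forall>v\<in>carrier E. 0 \<le> N v \<and> (N v = 0 \<longleftrightarrow> v = \<zero>\<^bsub>E\<^esub>)) \<and>
     (\<forall>c. \<forall>v\<in>carrier E. N (c \<odot>\<^bsub>E\<^esub> v) = \<bar>c\<bar> * N v) \<and>
     (\<forall>u\<in>carrier E. \<forall>v\<in>carrier E. N (u \<oplus>\<^bsub>E\<^esub> v) \<le> N u + N v) \<and>
     mcomplete_of (norm_metric E N)"

definition Lipschitz_with :: "real \<Rightarrow> 'a metric \<Rightarrow> 'b metric \<Rightarrow> ('a \<Rightarrow> 'b) \<Rightarrow> bool" where
  "Lipschitz_with L X Z f \<longleftrightarrow>
     f \<in> mspace X \<rightarrow> mspace Z \<and>
     (\<forall>x\<in>mspace X. \<forall>y\<in>mspace X. mdist Z (f x) (f y) \<le> L * mdist X x y)"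

definition Lip :: "'a metric \<Rightarrow> 'b metric \<Rightarrow> ('a \<Rightarrow> 'b) \<Rightarrow> real" where
  "Lip X Z f = Inf {L. 0 \<le> L \<and> Lipschitz_with L X Z f}"

text \<open>
  Only the distances between points of \<open>X\<close> are compared: the function \<^term>\<open>mdist X\<close> is arbitrary
  outside the carrier of \<open>X\<close>.
\<close>

definition metric_subspace :: "'a metric \<Rightarrow> 'a metric \<Rightarrow> bool" where
  "metric_subspace X Y \<longleftrightarrow>
     mspace X \<subseteq> mspace Y \<and> (\<forall>x\<in>mspace X. \<forall>y\<in>mspace X. mdist X x y = mdist Y x y)"

text \<open>
  All extension constants are extended reals, so that an empty infimum or an unbounded supremum
  is \<open>\<infinity>\<close>.
\<close>

definition ext_const :: "'a metric \<Rightarrow> 'a metric \<Rightarrow> 'b metric \<Rightarrow> ('a \<Rightarrow> 'b) \<Rightarrow> ereal" where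
  "ext_const X Y Z f =
     Inf {ereal K | K. 0 \<le> K \<and>
       (\<exists>g. Lipschitz_with (K * Lip X Z f) Y Z g \<and> (\<forall>x\<in>mspace X. g x = f x))}"

definition nu :: "'b itself \<Rightarrow> 'a metric \<Rightarrow> 'a metric \<Rightarrow> ereal" where
  "nu _ X Y =
     Sup {ext_const X Y (norm_metric E N) f | (E :: (real, 'b) module) N f.
       Banach_space E N \<and> Lipschitz_continuous_map X (norm_metric E N) f}"

definition ae_space :: "'b itself \<Rightarrow> 'a metric \<Rightarrow> ereal" where
  "ae_space T X = Sup {nu T X Y | Y. metric_subspace X Y}"

definition ae :: "'a itself \<Rightarrow> 'b itself \<Rightarrow> nat \<Rightarrow> ereal" where
  "ae _ T n = Sup {ae_space T X | X :: 'a metric. finite (mspace X) \<and> card (mspace X) = n}"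

end

theory Submission
  imports Defs
begin

text \<open>
  \<^bold>\<open>Upper bound.\<close> Four points, suitably labelled, embed isometrically into the plane with the
  \<open>l1\<close> metric as the tips of four antennas attached to the corners of a rectangle
  (\<open>four_points_in_plane\<close>). Every metric space containing the four points maps to this plane without
  increasing distances and fixing the four points, because \<open>s + t\<close> and \<open>s - t\<close> are real-valued
  1-Lipschitz functions and such functions extend. A map defined on the tips and on the four corners
  extends to the plane with the same Lipschitz constant: interpolate bilinearly on the rectangle and
  linearly along the antennas (\<open>extend_from_vertices\<close>). What remains is to extend from four points to
  eight.

  For that problem one seeks, for each of the eight points, coefficients with which its image is
  written as a combination of the images of the given four, such that every pair of points is
  stretched by at most \<open>K\<close>. By a separating hyperplane argument (\<open>affine_extension_bound\<close>) it suffices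
  to bound, for every choice of weights on the pairs with sum one, the weighted mean stretch by a suitable
  extension depending on the weights (\<open>weighted_extension_bound\<close>). The harmonic extension does it. Its
  mean stretch is the trace of a matrix \<open>B\<close> of Hilbert-Schmidt norm at most 1, compressed to a space of
  dimension at most 3, while the trace of the compression of \<open>B\<close> to an orthogonal space of
  dimension at most 4 makes up the difference to the full trace, which is at most 1.
  If the two traces are \<open>S\<close> and \<open>T\<close>, then \<open>S\<^sup>2 / 3 + T\<^sup>2 / 4 \<le> 1\<close> and
  \<open>S + T \<le> 1\<close>, whence \<open>S \<le> (3 + 6 * sqrt 2) / 7\<close>. This is the estimate of Koenig, Lewis and Lin for
  projections from a 7-dimensional onto a 3-dimensional space, here the Lipschitz-free spaces over
  eight and four points.

  \<^bold>\<open>Lower bound.\<close> Consider a tree with four leaves and two inner vertices, with leaf edges of length 1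
  and an inner edge of length \<open>sqrt 2 - 1\<close>, and map the leaves to \<open>\<real>\<^sup>3\<close> by evaluating
  functions that are 1-Lipschitz on the leaves. Five such functions, one for each edge, generate a norm
  in which adding up the corresponding functionals with suitable factors makes the images of the inner
  vertices cancel and leaves a lower bound for the Lipschitz constant of every extension to the tree
  (\<open>leaf_image_extension_bound\<close>).
\<close>

section \<open>Traces on orthogonal subspaces\<close>

text \<open>
  The bound of Koenig, Lewis and Lin for the relative projection constant of an \<open>n\<close>-dimensional
  subspace of an \<open>N\<close>-dimensional normed space.
\<close>

definition projection_bound :: "real \<Rightarrow> real \<Rightarrow> real" where
  "projection_bound n N = (n + sqrt (n * (N - n) * (N - 1))) / N"

lemma projection_bound_3_7: "projection_bound 3 7 = (3 + 6 * sqrt 2) / 7"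
proof -
  have "sqrt 72 = sqrt (36 * 2)" by simp
  also have "\<dots> = 6 * sqrt 2" by (subst real_sqrt_mult) simp
  finally show ?thesis by (simp add: projection_bound_def)
qed

text \<open>
  For \<open>S \<ge> 1\<close> the constraint is weakest at \<open>\<tau> = 1\<close>, where it is the quadratic inequality
  \<open>(S * N - n)\<^sup>2 \<le> n * q * (N - 1)\<close> with \<open>N = n + q\<close>. For \<open>S \<le> 1\<close> there is nothing to
  do, because \<open>n \<ge> 1\<close> makes the bound at least 1.
\<close>

lemma le_projection_bound:
  fixes S \<tau> n q :: real
  assumes n: "1 \<le> n" and q: "0 < q" and \<tau>: "\<tau> \<le> 1"
    and ineq: "S\<^sup>2 / n + (\<tau> - S)\<^sup>2 / q \<le> 1"
  shows "S \<le> projection_bound n (n + q)"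
proof -
  let ?N = "n + q"
  have *: "S * ?N - n \<le> sqrt (n * q * (?N - 1))"
  proof (cases "S \<le> 1")
    case True
    have "0 \<le> (n - 1) * ?N" using n q by simp
    then have "q * q \<le> q * (n * (?N - 1))"
      using q by (intro mult_left_mono) (auto simp: algebra_simps)
    then have "q \<le> sqrt (n * q * (?N - 1))"
      by (intro real_le_rsqrt) (simp add: power2_eq_square mult_ac)
    moreover have "S * ?N \<le> ?N" using True n q mult_right_mono[of S 1 ?N] by simp
    ultimately show ?thesis by (simp only: diff_le_eq)
  next
    case False
    then have "(S - 1)\<^sup>2 \<le> (S - \<tau>)\<^sup>2" using \<tau> by (intro power_mono) auto
    then have "(S - 1)\<^sup>2 / q \<le> (\<tau> - S)\<^sup>2 / q"
      using q by (intro divide_right_mono) (auto simp: power2_commute)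
    then have "S\<^sup>2 / n + (S - 1)\<^sup>2 / q \<le> 1" using ineq by linarith
    then have "(S\<^sup>2 / n + (S - 1)\<^sup>2 / q) * (n * q) \<le> 1 * (n * q)"
      using n q by (intro mult_right_mono) auto
    also have "(S\<^sup>2 / n + (S - 1)\<^sup>2 / q) * (n * q) = q * S\<^sup>2 + n * (S - 1)\<^sup>2"
      using n q by (simp add: field_simps)
    finally have "q * S\<^sup>2 + n * (S - 1)\<^sup>2 \<le> n * q" by simp
    then have "?N * (q * S\<^sup>2 + n * (S - 1)\<^sup>2) \<le> ?N * (n * q)"
      using n q by (intro mult_left_mono) auto
    then have "(S * ?N - n)\<^sup>2 \<le> n * q * (?N - 1)"
      by (simp add: power2_eq_square algebra_simps)
    then show ?thesis by (rule real_le_rsqrt)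
  qed
  then show ?thesis using n q by (simp add: projection_bound_def field_simps)
qed

text \<open>
  The two sums are the traces of the matrix with columns \<open>b e\<close>, compressed to the spans of \<open>U\<close> and
  \<open>Z\<close>. A trace on an \<open>n\<close>-dimensional space is a sum of \<open>n\<close> diagonal entries, which costs a factor
  \<open>n\<close> on squaring; all these diagonal entries together are controlled by the
  Hilbert-Schmidt norm through Bessel's inequality.
\<close>

lemma trace_on_orthogonal_subspaces:
  fixes b :: "'e::finite \<Rightarrow> real^'e"
  assumes fin: "finite U" "finite Z"
    and orth: "pairwise orthogonal (U \<union> Z)" and disj: "U \<inter> Z = {}"
    and unit: "\<And>u. u \<in> U \<union> Z \<Longrightarrow> norm u = 1"
    and b: "(\<Sum>e\<in>UNIV. (norm (b e))\<^sup>2) \<le> 1"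
    and card: "real (card U) \<le> n" "real (card Z) \<le> q" "0 < n" "0 < q"
  shows "(\<Sum>u\<in>U. \<Sum>e\<in>UNIV. u $ e * (u \<bullet> b e))\<^sup>2 / n
       + (\<Sum>z\<in>Z. \<Sum>e\<in>UNIV. z $ e * (z \<bullet> b e))\<^sup>2 / q \<le> 1"
proof -
  define s where "s u = (\<Sum>e\<in>UNIV. u $ e * (u \<bullet> b e))" for u :: "real^'e"
  have s_le: "(s u)\<^sup>2 \<le> (\<Sum>e\<in>UNIV. (u \<bullet> b e)\<^sup>2)" if "u \<in> U \<union> Z" for u
  proof -
    have "(s u)\<^sup>2 \<le> (\<Sum>e\<in>UNIV. (u $ e)\<^sup>2) * (\<Sum>e\<in>UNIV. (u \<bullet> b e)\<^sup>2)"
      unfolding s_def by (rule Cauchy_Schwarz_ineq_sum)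
    also have "(\<Sum>e\<in>UNIV. (u $ e)\<^sup>2) = 1"
      using unit[OF that] by (simp add: norm_eq_1 inner_vec_def power2_eq_square)
    finally show ?thesis by simp
  qed
  have bessel: "(\<Sum>u\<in>U \<union> Z. (u \<bullet> v)\<^sup>2) \<le> (norm v)\<^sup>2" for v :: "real^'e"
  proof -
    let ?P = "\<Sum>u\<in>U \<union> Z. (u \<bullet> v) *\<^sub>R u"
    have eq: "u \<bullet> u' = (if u = u' then 1 else 0)" if "u \<in> U \<union> Z" "u' \<in> U \<union> Z" for u u'
      using that orth unit by (auto simp: pairwise_def orthogonal_def norm_eq_1)
    have 1: "?P \<bullet> v = (\<Sum>u\<in>U \<union> Z. (u \<bullet> v)\<^sup>2)"
      by (simp add: inner_sum_left power2_eq_square)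
    have "?P \<bullet> ?P = (\<Sum>u\<in>U \<union> Z. (u \<bullet> v) * (\<Sum>u'\<in>U \<union> Z. (u' \<bullet> v) * (u' \<bullet> u)))"
      by (simp add: inner_sum_left inner_sum_right sum_distrib_left inner_commute mult_ac)
    also have "\<dots> = (\<Sum>u\<in>U \<union> Z. (u \<bullet> v) * (\<Sum>u'\<in>U \<union> Z. if u' = u then u \<bullet> v else 0))"
      by (intro sum.cong arg_cong2[where f="(*)"] refl) (simp add: eq)
    also have "\<dots> = (\<Sum>u\<in>U \<union> Z. (u \<bullet> v)\<^sup>2)"
      using fin by (simp add: power2_eq_square)
    finally have 2: "?P \<bullet> ?P = (\<Sum>u\<in>U \<union> Z. (u \<bullet> v)\<^sup>2)" .
    have "0 \<le> (v - ?P) \<bullet> (v - ?P)" by simp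
    also have "\<dots> = v \<bullet> v - 2 * (?P \<bullet> v) + ?P \<bullet> ?P"
      by (simp add: inner_diff_left inner_diff_right inner_commute)
    finally show ?thesis using 1 2 by (simp add: power2_norm_eq_inner)
  qed
  have part: "(sum s F)\<^sup>2 / r \<le> (\<Sum>u\<in>F. (s u)\<^sup>2)"
    if "finite F" "real (card F) \<le> r" "0 < r" for F :: "(real^'e) set" and r
  proof -
    have "(sum s F)\<^sup>2 \<le> real (card F) * (\<Sum>u\<in>F. (s u)\<^sup>2)"
      using Cauchy_Schwarz_ineq_sum[of "\<lambda>_. 1" s F] by simp
    also have "\<dots> \<le> r * (\<Sum>u\<in>F. (s u)\<^sup>2)"
      using that by (intro mult_right_mono sum_nonneg) auto
    finally show ?thesis using that by (simp add: divide_le_eq mult.commute)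
  qed
  have "(sum s U)\<^sup>2 / n + (sum s Z)\<^sup>2 / q \<le> (\<Sum>u\<in>U. (s u)\<^sup>2) + (\<Sum>u\<in>Z. (s u)\<^sup>2)"
    using part[of U n] part[of Z q] fin card by simp
  also have "\<dots> = (\<Sum>u\<in>U \<union> Z. (s u)\<^sup>2)" using fin disj by (simp add: sum.union_disjoint)
  also have "\<dots> \<le> (\<Sum>u\<in>U \<union> Z. \<Sum>e\<in>UNIV. (u \<bullet> b e)\<^sup>2)" by (intro sum_mono s_le)
  also have "\<dots> = (\<Sum>e\<in>UNIV. \<Sum>u\<in>U \<union> Z. (u \<bullet> b e)\<^sup>2)" by (rule sum.swap)
  also have "\<dots> \<le> (\<Sum>e\<in>UNIV. (norm (b e))\<^sup>2)" by (intro sum_mono bessel)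
  also have "\<dots> \<le> 1" by (rule b)
  finally show ?thesis by (simp add: s_def)
qed

section \<open>Norming functionals of seminorms\<close>

definition seminorm :: "('v::real_vector \<Rightarrow> real) \<Rightarrow> bool" where
  "seminorm p \<longleftrightarrow> (\<forall>x y. p (x + y) \<le> p x + p y) \<and> (\<forall>c x. p (c *\<^sub>R x) = \<bar>c\<bar> * p x)"

lemma seminorm_add: "seminorm p \<Longrightarrow> p (x + y) \<le> p x + p y"
  and seminorm_scale: "seminorm p \<Longrightarrow> p (c *\<^sub>R x) = \<bar>c\<bar> * p x"
  by (auto simp: seminorm_def)

lemma seminorm_zero: "seminorm p \<Longrightarrow> p 0 = 0"
  using seminorm_scale[of p 0 0] by simp

lemma seminorm_minus_commute: "seminorm p \<Longrightarrow> p (x - y) = p (y - x)"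
  using seminorm_scale[of p "-1" "x - y"] by simp

lemma seminorm_nonneg: assumes "seminorm p" shows "0 \<le> p x"
  using seminorm_add[OF assms, of x "-x"] seminorm_zero[OF assms]
    seminorm_minus_commute[OF assms, of x 0] by simp

lemma seminorm_convex:
  assumes "seminorm p" "0 \<le> u" "0 \<le> v"
  shows "p (u *\<^sub>R x + v *\<^sub>R y) \<le> u * p x + v * p y"
  using seminorm_add[OF assms(1), of "u *\<^sub>R x" "v *\<^sub>R y"] assms by (simp add: seminorm_scale)

text \<open>
  A hyperplane supporting the ball of radius \<open>p x0\<close> at \<open>x0\<close>, suitably scaled, is the required
  functional.
\<close>

lemma seminorm_norming_functional:
  fixes p :: "'v::euclidean_space \<Rightarrow> real"
  assumes p: "seminorm p"
  shows "\<exists>a. (\<forall>x. a \<bullet> x \<le> p x) \<and> a \<bullet> x0 = p x0"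
proof (cases "p x0 = 0")
  case True
  then show ?thesis by (intro exI[of _ 0]) (auto simp: seminorm_nonneg[OF p])
next
  case False
  then have pos: "p x0 > 0" using seminorm_nonneg[OF p, of x0] by simp
  let ?S = "{x. p x < p x0}"
  have "convex ?S"
  proof (rule convexI)
    fix x y u v assume "x \<in> ?S" "y \<in> ?S" and uv: "0 \<le> u" "0 \<le> v" "u + v = (1::real)"
    then have "u * p x + v * p y < p x0"
      using convex_bound_lt[of "p x" "p x0" "p y" u v] by simp
    then show "u *\<^sub>R x + v *\<^sub>R y \<in> ?S" using seminorm_convex[OF p uv(1,2), of x y] by simp
  qed
  moreover have "0 \<in> ?S" using pos seminorm_zero[OF p] by simp
  ultimately obtain a c where a: "a \<noteq> 0" and le: "\<And>x. x \<in> ?S \<Longrightarrow> a \<bullet> x \<le> c" and "c \<le> a \<bullet> x0"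
    using separating_hyperplane_sets[of ?S "{x0}"] by auto
  have below: "a \<bullet> x * p x0 \<le> a \<bullet> x0 * r" if "p x < r" for x r
  proof -
    have r: "r > 0" using that seminorm_nonneg[OF p, of x] by simp
    have "(p x0 / r) *\<^sub>R x \<in> ?S" using that r pos by (simp add: seminorm_scale[OF p] field_simps)
    then have "a \<bullet> ((p x0 / r) *\<^sub>R x) \<le> a \<bullet> x0" using le \<open>c \<le> a \<bullet> x0\<close> by force
    then show ?thesis using r by (simp add: field_simps)
  qed
  have "a \<bullet> x0 \<ge> 0" using below[of 0 1] seminorm_zero[OF p] by simp
  moreover have "a \<bullet> x0 \<noteq> 0"
  proof
    assume "a \<bullet> x0 = 0"
    then have "a \<bullet> a * p x0 \<le> 0" using below[of a "p a + 1"] by simp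
    then have "a \<bullet> a \<le> 0" using pos by (simp add: mult_le_0_iff)
    moreover have "a \<bullet> a > 0" using a by simp
    ultimately show False by linarith
  qed
  ultimately have a0: "a \<bullet> x0 > 0" by simp
  have bound: "a \<bullet> x * p x0 \<le> a \<bullet> x0 * p x" for x
  proof (rule dense_ge)
    fix t assume "a \<bullet> x0 * p x < t"
    then have "p x < t / (a \<bullet> x0)" using a0 by (simp add: field_simps)
    from below[OF this] show "a \<bullet> x * p x0 \<le> t" using a0 by simp
  qed
  let ?a = "(p x0 / (a \<bullet> x0)) *\<^sub>R a"
  have "?a \<bullet> x \<le> p x" for x using bound[of x] a0 by (simp add: field_simps)
  moreover have "?a \<bullet> x0 = p x0" using a0 by simp
  ultimately show ?thesis by blast
qed

section \<open>Harmonic extension\<close>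

lemma sqrt_mult_self_weight: "0 \<le> w \<Longrightarrow> sqrt w * (sqrt w * x) = w * (x::real)"
  by (simp add: mult.assoc[symmetric])

lemma square_sqrt_mult: "0 \<le> w \<Longrightarrow> (sqrt w * x) * (sqrt w * x) = w * (x::real)\<^sup>2"
  by (simp add: power2_eq_square[symmetric] power_mult_distrib)

text \<open>
  Finite metric spaces are presented as pseudometrics \<open>d\<close> on a finite index type. Indices at distance
  0 stand for the same point, and functions on the space are the functions of the index that do not
  tell them apart. In this way the vertices of a degenerate configuration may coincide.
\<close>

definition compatible :: "('m::finite \<Rightarrow> 'm \<Rightarrow> real) \<Rightarrow> (real^'m) set" where
  "compatible d = {h. \<forall>i j. d i j = 0 \<longrightarrow> h $ i = h $ j}"

text \<open>
  The squared norm of this vector is the Dirichlet energy of \<open>h\<close> with conductances \<open>w e / d\<^sup>2\<close>. Pairs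
  at distance 0 contribute 0, as division by zero gives zero.
\<close>

definition weighted_slopes ::
    "('m::finite \<Rightarrow> 'm \<Rightarrow> real) \<Rightarrow> ('m \<times> 'm \<Rightarrow> real) \<Rightarrow> real^'m \<Rightarrow> real^('m \<times> 'm)" where
  "weighted_slopes d w h = (\<chi> e. sqrt (w e) * ((h $ fst e - h $ snd e) / d (fst e) (snd e)))"

lemma linear_weighted_slopes: "linear (weighted_slopes d w)"
  by (rule linearI)
    (simp_all add: weighted_slopes_def vec_eq_iff algebra_simps add_divide_distrib diff_divide_distrib)

lemma subspace_compatible: "subspace (compatible d)"
  by (auto simp: compatible_def subspace_def)

definition pseudometric :: "('m \<Rightarrow> 'm \<Rightarrow> real) \<Rightarrow> bool" where
  "pseudometric d \<longleftrightarrow> (\<forall>i j. 0 \<le> d i j) \<and> (\<forall>i. d i i = 0) \<and> (\<forall>i j. d i j = d j i) \<and>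
     (\<forall>i j k. d i k \<le> d i j + d j k)"

lemma pseudometric_cong:
  assumes "pseudometric d" "d i j = 0"
  shows "d i k = d j k"
  using assms unfolding pseudometric_def by (smt (verit, best))

text \<open>
  \<open>\<Phi> k\<close> minimizes the Dirichlet energy among the functions with boundary values \<open>indicator {k}\<close> on
  \<open>J\<close>. It is obtained from any function with these boundary values by subtracting an orthogonal
  projection. As some weights may vanish, the energy need not determine the minimizer, and independent
  choices need not add up to 1.
\<close>

lemma harmonic_extension:
  fixes d :: "'m::finite \<Rightarrow> 'm \<Rightarrow> real"
  assumes d: "pseudometric d" and J: "J \<noteq> {}"
    and sep: "\<And>x y. x \<in> J \<Longrightarrow> y \<in> J \<Longrightarrow> x \<noteq> y \<Longrightarrow> d x y \<noteq> 0"
  obtains \<Phi> :: "'m \<Rightarrow> real^'m"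
  where "\<And>k. k \<in> J \<Longrightarrow> \<Phi> k \<in> compatible d"
    and "\<And>k x. k \<in> J \<Longrightarrow> x \<in> J \<Longrightarrow> \<Phi> k $ x = (if x = k then 1 else 0)"
    and "(\<Sum>k\<in>J. \<Phi> k) = (\<chi> i. 1)"
    and "\<And>k h. k \<in> J \<Longrightarrow> h \<in> compatible d \<Longrightarrow> \<forall>x\<in>J. h $ x = 0 \<Longrightarrow>
           weighted_slopes d w (\<Phi> k) \<bullet> weighted_slopes d w h = 0"
proof -
  let ?A = "weighted_slopes d w"
  let ?V0 = "{h. h \<in> compatible d \<and> (\<forall>x\<in>J. h $ x = 0)}"
  have sV0: "subspace ?V0"
    using subspace_compatible[of d] by (auto simp: subspace_def)
  have sW: "subspace (?A ` ?V0)" by (rule linear_subspace_image[OF linear_weighted_slopes sV0])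
  have ex: "\<exists>g \<in> compatible d. (\<forall>x\<in>J. g $ x = (if x = k then 1 else 0)) \<and> (\<forall>h\<in>?V0. ?A g \<bullet> ?A h = 0)"
    if k: "k \<in> J" for k
  proof -
    define e :: "real^'m" where "e = (\<chi> i. if d i k = 0 then 1 else 0)"
    have e: "e \<in> compatible d"
      unfolding compatible_def e_def
    proof (intro CollectI allI impI)
      fix i j assume "d i j = 0"
      then have "d i k = d j k" by (rule pseudometric_cong[OF d])
      then show "(\<chi> i. if d i k = 0 then 1 else 0) $ i = (\<chi> i. if d i k = 0 then 1 else 0) $ j"
        by simp
    qed
    have eJ: "e $ x = (if x = k then 1 else 0)" if "x \<in> J" for x
    proof (cases "x = k")
      case True
      have "d k k = 0" using d unfolding pseudometric_def by blast
      then show ?thesis using True by (simp add: e_def)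
    next
      case False
      then show ?thesis using sep[OF that k] by (simp add: e_def)
    qed
    obtain y z where y: "y \<in> span (?A ` ?V0)" and z: "\<And>u. u \<in> span (?A ` ?V0) \<Longrightarrow> orthogonal z u"
      and Ae: "?A e = y + z"
      by (rule orthogonal_subspace_decomp_exists[of "?A ` ?V0" "?A e"]) auto
    have "span (?A ` ?V0) = ?A ` ?V0" using sW by (simp only: span_eq_iff)
    with y obtain h0 where h0: "h0 \<in> ?V0" "y = ?A h0" by blast
    have "?A (e - h0) = z" using Ae h0 by (simp add: linear_diff[OF linear_weighted_slopes])
    moreover have "e - h0 \<in> compatible d" using e h0 subspace_compatible by (auto intro: subspace_diff)
    moreover have "(e - h0) $ x = (if x = k then 1 else 0)" if "x \<in> J" for x
      using eJ[OF that] h0 that by simp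
    moreover have "z \<bullet> ?A h = 0" if "h \<in> ?V0" for h
      using z[of "?A h"] span_base[of "?A h" "?A ` ?V0"] that by (simp add: orthogonal_def)
    ultimately show ?thesis by (intro bexI[of _ "e - h0"] conjI ballI) simp_all
  qed
  have "\<forall>k\<in>J. \<exists>g. g \<in> compatible d \<and> (\<forall>x\<in>J. g $ x = (if x = k then 1 else 0)) \<and> (\<forall>h\<in>?V0. ?A g \<bullet> ?A h = 0)"
    using ex by (simp only: Bex_def) blast
  from bchoice[OF this] obtain g where g: "\<And>k. k \<in> J \<Longrightarrow> g k \<in> compatible d"
    "\<And>k x. k \<in> J \<Longrightarrow> x \<in> J \<Longrightarrow> g k $ x = (if x = k then 1 else 0)"
    "\<And>k h. k \<in> J \<Longrightarrow> h \<in> ?V0 \<Longrightarrow> ?A (g k) \<bullet> ?A h = 0"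
    by blast
  obtain k0 where k0: "k0 \<in> J" using J by auto
  define one :: "real^'m" where "one = (\<chi> i. 1)"
  \<comment> \<open>one of the minimizers is redefined, which is harmless as constants have energy 0\<close>
  define \<Phi> where "\<Phi> k = (if k = k0 then one - (\<Sum>k\<in>J - {k0}. g k) else g k)" for k
  have one: "one \<in> compatible d" by (simp add: one_def compatible_def)
  have A_one: "?A one = 0" by (simp add: weighted_slopes_def one_def vec_eq_iff)
  show ?thesis
  proof (rule that[of \<Phi>])
    show "\<Phi> k \<in> compatible d" if "k \<in> J" for k
      using that g(1) one subspace_compatible[of d]
      by (auto simp: \<Phi>_def intro!: subspace_diff subspace_sum)
    show "\<Phi> k $ x = (if x = k then 1 else 0)" if k: "k \<in> J" and x: "x \<in> J" for k x
    proof (cases "k = k0")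
      case True
      have "(\<Sum>k\<in>J - {k0}. g k) $ x = (\<Sum>k\<in>J - {k0}. if x = k then 1 else 0)"
        using x by (simp add: g(2))
      also have "\<dots> = (if x = k0 then 0 else 1)" using x by simp
      finally show ?thesis using True by (simp add: \<Phi>_def one_def)
    qed (use k x g(2) in \<open>simp add: \<Phi>_def\<close>)
    have "(\<Sum>k\<in>J. \<Phi> k) = \<Phi> k0 + (\<Sum>k\<in>J - {k0}. \<Phi> k)" using k0 by (simp add: sum.remove)
    also have "(\<Sum>k\<in>J - {k0}. \<Phi> k) = (\<Sum>k\<in>J - {k0}. g k)" by (intro sum.cong) (auto simp: \<Phi>_def)
    finally show "(\<Sum>k\<in>J. \<Phi> k) = (\<chi> i. 1)" by (simp add: \<Phi>_def one_def)
    show "?A (\<Phi> k) \<bullet> ?A h = 0"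
      if "k \<in> J" "h \<in> compatible d" "\<forall>x\<in>J. h $ x = 0" for k h
    proof (cases "k = k0")
      case True
      have "?A (\<Phi> k) = - (\<Sum>k\<in>J - {k0}. ?A (g k))"
        using True by (simp add: \<Phi>_def linear_diff[OF linear_weighted_slopes] A_one
            linear_sum[OF linear_weighted_slopes])
      then show ?thesis using that by (simp add: inner_sum_left g(3))
    qed (use that g(3) in \<open>simp add: \<Phi>_def\<close>)
  qed
qed

text \<open>
  The infimal convolution \<open>h i = min (a x + d x i)\<close> is the largest 1-Lipschitz extension of \<open>a\<close>.
\<close>

lemma mcshane_extension:
  fixes d :: "'a \<Rightarrow> 'a \<Rightarrow> real"
  assumes sym: "\<And>i j. d i j = d j i" and nonneg: "\<And>i j. 0 \<le> d i j"
    and tri: "\<And>i j k. i \<in> C \<Longrightarrow> j \<in> C \<Longrightarrow> k \<in> C \<Longrightarrow> d i k \<le> d i j + d j k"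
    and refl: "\<And>i. i \<in> J \<Longrightarrow> d i i = 0"
    and J: "finite J" "J \<noteq> {}" "J \<subseteq> C"
    and a: "\<And>x y. x \<in> J \<Longrightarrow> y \<in> J \<Longrightarrow> a x - a y \<le> d x y"
  obtains h :: "'a \<Rightarrow> real"
  where "\<And>x. x \<in> J \<Longrightarrow> h x = a x" and "\<And>i j. i \<in> C \<Longrightarrow> j \<in> C \<Longrightarrow> \<bar>h i - h j\<bar> \<le> d i j"
proof -
  define h where "h i = Min ((\<lambda>x. a x + d x i) ` J)" for i
  have le: "h i \<le> a x + d x i" if "x \<in> J" for x i
    using that J by (auto simp: h_def intro!: Min_le)
  have ex: "\<exists>x\<in>J. h i = a x + d x i" for i
  proof -
    have "h i \<in> (\<lambda>x. a x + d x i) ` J"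
      unfolding h_def using J by (intro Min_in) auto
    then show ?thesis by blast
  qed
  have lip: "h i - h j \<le> d i j" if "i \<in> C" "j \<in> C" for i j
  proof -
    obtain x where x: "x \<in> J" "h j = a x + d x j" using ex by blast
    moreover have "d x i \<le> d x j + d j i" using x J that by (intro tri) auto
    ultimately show ?thesis using le[of x i] sym[of i j] by simp
  qed
  show ?thesis
  proof (rule that[of h])
    show "h x = a x" if "x \<in> J" for x
    proof -
      obtain y where "y \<in> J" "h x = a y + d y x" using ex by blast
      then have "a x \<le> h x" using a[of x y] that sym[of x y] by simp
      moreover have "h x \<le> a x" using le[OF that, of x] refl[OF that] by simp
      ultimately show ?thesis by simp
    qed
    show "\<bar>h i - h j\<bar> \<le> d i j" if "i \<in> C" "j \<in> C" for i j
      using lip[OF that] lip[OF that(2,1)] sym[of i j] by (simp add: abs_le_iff)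
  qed
qed

section \<open>Extension to finitely many points\<close>

text \<open>
  The vector \<open>\<phi> i\<close> lists the coefficients with which the image of \<open>i\<close> is combined from the images of
  the points of \<open>J\<close>.
\<close>

definition affine_extension ::
    "('m::finite \<Rightarrow> 'm \<Rightarrow> real) \<Rightarrow> 'm set \<Rightarrow> ('m \<Rightarrow> real^'m) \<Rightarrow> bool" where
  "affine_extension d J \<phi> \<longleftrightarrow> (\<forall>i. \<forall>k. k \<notin> J \<longrightarrow> \<phi> i $ k = 0) \<and> (\<forall>x\<in>J. \<phi> x = axis x 1) \<and>
     (\<forall>i j. d i j = 0 \<longrightarrow> \<phi> i = \<phi> j)"

text \<open>
  \<open>\<phi>\<close> is harmonic extension for the conductances given by \<open>w\<close>. By a norming functional for each pair
  \<open>e\<close>, its weighted mean stretch becomes a sum of slopes of harmonic functions \<open>H e\<close>. Here \<open>H e\<close> is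
  the orthogonal projection, in the energy norm, of a function \<open>h e\<close> on the whole space that is
  1-Lipschitz, so that the slopes of all \<open>h e\<close>, before weighting, form a matrix with entries in
  \<open>[-1, 1]\<close>. The sum is therefore the trace of that matrix on the space of harmonic functions, of dimension
  \<open>card J - 1\<close> at most as constants have no slope. The functions vanishing on \<open>J\<close> form its orthogonal
  complement and carry the rest of the trace.
\<close>

lemma weighted_extension_bound:
  fixes d :: "'m::finite \<Rightarrow> 'm \<Rightarrow> real" and p :: "real^'m \<Rightarrow> real"
  assumes d: "pseudometric d" and p: "seminorm p"
    and J: "2 \<le> card J" "J \<noteq> UNIV"
    and sep: "\<And>x y. x \<in> J \<Longrightarrow> y \<in> J \<Longrightarrow> x \<noteq> y \<Longrightarrow> d x y \<noteq> 0"
    and pJ: "\<And>x y. x \<in> J \<Longrightarrow> y \<in> J \<Longrightarrow> p (axis x 1 - axis y 1) \<le> d x y"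
    and w: "\<And>e. 0 \<le> w e" "sum w UNIV = 1"
  shows "\<exists>\<phi>. affine_extension d J \<phi> \<and>
     (\<Sum>e\<in>UNIV. w e * (p (\<phi> (fst e) - \<phi> (snd e)) / d (fst e) (snd e)))
       \<le> projection_bound (card J - 1) (CARD('m) - 1)"
proof -
  let ?A = "weighted_slopes d w"
  let ?V0 = "{h. h \<in> compatible d \<and> (\<forall>x\<in>J. h $ x = 0)}"
  have Jne: "J \<noteq> {}" using J by auto
  have dnn: "0 \<le> d i j" for i j using d by (simp add: pseudometric_def)
  obtain \<Phi> :: "'m \<Rightarrow> real^'m" where \<Phi>V: "\<And>k. k \<in> J \<Longrightarrow> \<Phi> k \<in> compatible d"
    and \<Phi>J: "\<And>k x. k \<in> J \<Longrightarrow> x \<in> J \<Longrightarrow> \<Phi> k $ x = (if x = k then 1 else 0)"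
    and \<Phi>1: "(\<Sum>k\<in>J. \<Phi> k) = (\<chi> i. 1)"
    and \<Phi>orth: "\<And>k h. k \<in> J \<Longrightarrow> h \<in> compatible d \<Longrightarrow> \<forall>x\<in>J. h $ x = 0 \<Longrightarrow> ?A (\<Phi> k) \<bullet> ?A h = 0"
    using harmonic_extension[OF d Jne sep, where w = w] by blast
  define \<phi> :: "'m \<Rightarrow> real^'m" where "\<phi> i = (\<chi> k. if k \<in> J then \<Phi> k $ i else 0)" for i
  have adm: "affine_extension d J \<phi>"
    using \<Phi>V \<Phi>J by (auto simp: affine_extension_def \<phi>_def vec_eq_iff axis_def compatible_def)
  \<comment> \<open>norming functionals, turned into 1-Lipschitz functions on the whole space\<close>
  have "\<exists>a. (\<forall>x. a \<bullet> x \<le> p x) \<and> a \<bullet> (\<phi> (fst e) - \<phi> (snd e)) = p (\<phi> (fst e) - \<phi> (snd e))" for e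
    by (rule seminorm_norming_functional[OF p])
  then obtain a where a_le: "\<And>e x. a e \<bullet> x \<le> p x"
    and a_eq: "\<And>e. a e \<bullet> (\<phi> (fst e) - \<phi> (snd e)) = p (\<phi> (fst e) - \<phi> (snd e))" by metis
  have a_lip: "a e $ x - a e $ y \<le> d x y" if "x \<in> J" "y \<in> J" for e x y
    using a_le[of e "axis x 1 - axis y 1"] pJ[OF that] by (simp add: inner_diff_right inner_axis)
  have "\<exists>h :: real^'m. (\<forall>x\<in>J. h $ x = a e $ x) \<and> (\<forall>i j. \<bar>h $ i - h $ j\<bar> \<le> d i j)" for e
  proof -
    obtain g where "\<And>x. x \<in> J \<Longrightarrow> g x = a e $ x" "\<And>i j. i \<in> UNIV \<Longrightarrow> j \<in> UNIV \<Longrightarrow> \<bar>g i - g j\<bar> \<le> d i j"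
    proof (rule mcshane_extension[of d UNIV J "\<lambda>x. a e $ x"])
      show "d i k \<le> d i j + d j k" "d i j = d j i" "d i i = 0" for i j k
        using d unfolding pseudometric_def by blast+
    qed (use dnn Jne a_lip in auto)
    then show ?thesis by (intro exI[of _ "\<chi> i. g i"]) simp
  qed
  then obtain h :: "'m \<times> 'm \<Rightarrow> real^'m" where hJ: "\<And>e x. x \<in> J \<Longrightarrow> h e $ x = a e $ x"
    and h_lip: "\<And>e i j. \<bar>h e $ i - h e $ j\<bar> \<le> d i j" by metis
  have hV: "h e \<in> compatible d" for e
    unfolding compatible_def by (auto) (metis h_lip abs_le_zero_iff eq_iff_diff_eq_0)
  define H where "H e = (\<Sum>k\<in>J. h e $ k *\<^sub>R \<Phi> k)" for e
  have HV: "H e \<in> compatible d" for e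
    unfolding H_def by (intro subspace_sum subspace_compatible subspace_scale \<Phi>V)
  have HJ: "H e $ x = h e $ x" if "x \<in> J" for e x
  proof -
    have "H e $ x = (\<Sum>k\<in>J. if x = k then h e $ k else 0)"
      unfolding H_def sum_component using that by (intro sum.cong) (auto simp: \<Phi>J)
    also have "\<dots> = h e $ x" using that by simp
    finally show ?thesis .
  qed
  have diffV0: "h e - H e \<in> ?V0" for e
    using HJ hV HV subspace_diff[OF subspace_compatible[of d]] by auto
  \<comment> \<open>\<open>W\<close> contains the slopes of the harmonic functions; one generator is redundant\<close>
  obtain k0 where k0: "k0 \<in> J" using Jne by auto
  define W where "W = span ((\<lambda>k. ?A (\<Phi> k)) ` (J - {k0}))"
  have "0 = ?A (\<Sum>k\<in>J. \<Phi> k)" unfolding \<Phi>1 by (simp add: weighted_slopes_def vec_eq_iff)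
  also have "\<dots> = ?A (\<Phi> k0) + (\<Sum>k\<in>J - {k0}. ?A (\<Phi> k))"
    using k0 by (simp add: linear_sum[OF linear_weighted_slopes] linear_add[OF linear_weighted_slopes] sum.remove)
  finally have A_k0: "?A (\<Phi> k0) = - (\<Sum>k\<in>J - {k0}. ?A (\<Phi> k))" by (simp add: eq_neg_iff_add_eq_0)
  have A\<Phi>W: "?A (\<Phi> k) \<in> W" if "k \<in> J" for k
  proof (cases "k = k0")
    case True
    then show ?thesis unfolding True A_k0 W_def by (intro span_neg span_sum span_base) auto
  qed (use that in \<open>auto simp: W_def intro: span_base\<close>)
  have sW: "subspace W" by (simp add: W_def)
  have AHW: "?A (H e) \<in> W" for e
    unfolding H_def linear_sum[OF linear_weighted_slopes] linear_scale[OF linear_weighted_slopes]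
    by (intro subspace_sum subspace_scale sW A\<Phi>W)
  have W_orth: "v \<bullet> ?A g = 0" if "v \<in> W" "g \<in> ?V0" for v g
  proof -
    have "orthogonal (?A g) v"
      using that(1) unfolding W_def
      by (rule orthogonal_to_span) (use that(2) \<Phi>orth in \<open>auto simp: orthogonal_def inner_commute\<close>)
    then show ?thesis by (simp add: orthogonal_def inner_commute)
  qed
  have dimW: "real (dim W) \<le> real (card J) - 1"
  proof -
    have "dim W \<le> card ((\<lambda>k. ?A (\<Phi> k)) ` (J - {k0}))" unfolding W_def dim_span
      by (intro dim_le_card span_superset) auto
    also have "\<dots> \<le> card (J - {k0})" by (rule card_image_le) auto
    also have "\<dots> = card J - 1" using k0 by simp
    finally show ?thesis using J by linarith
  qed
  have sV0: "subspace ?V0" using subspace_compatible[of d] by (auto simp: subspace_def)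
  have sZ: "subspace (?A ` ?V0)" by (rule linear_subspace_image[OF linear_weighted_slopes sV0])
  \<comment> \<open>the slopes of the functions vanishing on \<open>J\<close>\<close>
  have dimZ: "dim (?A ` ?V0) \<le> CARD('m) - card J"
  proof -
    have "dim (?A ` ?V0) \<le> dim ?V0" by (rule dim_image_le[OF linear_weighted_slopes])
    also have "\<dots> \<le> dim {x::real^'m. \<forall>i. i \<notin> - J \<longrightarrow> x $ i = 0}" by (rule dim_subset) auto
    also have "\<dots> = card (- J)" 
      using dim_substandard_cart[of "- J", where ?'a = real] unfolding dim_vec_eq .
    also have "\<dots> = CARD('m) - card J" by (simp add: Compl_eq_Diff_UNIV card_Diff_subset)
    finally show ?thesis .
  qed
  have cJ: "card J < CARD('m)" using J(2) by (simp add: psubset_card_mono psubset_eq)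
  obtain U where U: "U \<subseteq> W" "pairwise orthogonal U" "\<And>x. x \<in> U \<Longrightarrow> norm x = 1"
      "independent U" "card U = dim W" "span U = W"
    by (rule orthonormal_basis_subspace[OF sW]) blast
  obtain Z where Z: "Z \<subseteq> ?A ` ?V0" "pairwise orthogonal Z" "\<And>x. x \<in> Z \<Longrightarrow> norm x = 1"
      "independent Z" "card Z = dim (?A ` ?V0)" "span Z = ?A ` ?V0"
    by (rule orthonormal_basis_subspace[OF sZ]) blast
  have finU: "finite U" and finZ: "finite Z" using U Z by (auto intro: finiteI_independent)
  have UZ: "u \<bullet> z = 0" if "u \<in> U" "z \<in> Z" for u z
    using W_orth that U(1) Z(1) by blast
  have disj: "U \<inter> Z = {}" 
  proof (rule ccontr)
    assume "U \<inter> Z \<noteq> {}"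
    then obtain u where "u \<in> U" "u \<in> Z" by blast
    then have "u \<bullet> u = 0" "norm u = 1" using UZ U(3) by auto
    then show False by simp
  qed
  have orth: "pairwise orthogonal (U \<union> Z)"
  proof -
    have "z \<bullet> u = 0" if "u \<in> U" "z \<in> Z" for u z
      using UZ[OF that] by (simp add: inner_commute)
    with UZ U(2) Z(2) show ?thesis unfolding pairwise_def orthogonal_def by blast
  qed
  have expand: "v = (\<Sum>u\<in>F. (u \<bullet> v) *\<^sub>R u)"
    if "finite F" "pairwise orthogonal F" "\<And>x. x \<in> F \<Longrightarrow> norm x = 1" "v \<in> span F" for F and v :: "real^('m\<times>'m)"
    using orthonormal_basis_expand[OF that(2,3,4,1)] by (simp add: inner_commute)
  define b where "b e = sqrt (w e) *\<^sub>R ?A (h e)" for e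
  have slope: "((h e $ fst e' - h e $ snd e') / d (fst e') (snd e'))\<^sup>2 \<le> 1" for e e'
  proof -
    have "\<bar>(h e $ fst e' - h e $ snd e') / d (fst e') (snd e')\<bar> \<le> 1"
      using h_lip[of e "fst e'" "snd e'"] dnn[of "fst e'" "snd e'"]
      by (cases "d (fst e') (snd e') = 0") (auto simp: abs_divide divide_le_eq_1)
    then show ?thesis by (simp add: abs_square_le_1)
  qed
  have b_norm: "(norm (b e))\<^sup>2 \<le> w e" for e
  proof -
    have "(norm (?A (h e)))\<^sup>2
        = (\<Sum>e'\<in>UNIV. w e' * ((h e $ fst e' - h e $ snd e') / d (fst e') (snd e'))\<^sup>2)"
      unfolding power2_norm_eq_inner inner_vec_def weighted_slopes_def
      unfolding vec_lambda_beta inner_real_def using w by (simp only: square_sqrt_mult)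
    also have "\<dots> \<le> (\<Sum>e'\<in>UNIV. w e' * 1)" by (intro sum_mono mult_left_mono slope w)
    finally have "(norm (?A (h e)))\<^sup>2 \<le> 1" using w by simp
    then show ?thesis using w(1)[of e] mult_left_mono[of "(norm (?A (h e)))\<^sup>2" 1 "w e"]
      by (simp add: b_def power_mult_distrib)
  qed
  have "(\<Sum>e\<in>UNIV. (norm (b e))\<^sup>2) \<le> 1" using sum_mono[of UNIV "\<lambda>e. (norm (b e))\<^sup>2" w] b_norm w(2) by simp
  note trace = trace_on_orthogonal_subspaces[OF finU finZ orth disj _ this,
      of "real (card J) - 1" "real (CARD('m)) - real (card J)"]
  define S where "S = (\<Sum>e\<in>UNIV. sqrt (w e) * ?A (H e) $ e)"
  define T where "T = (\<Sum>e\<in>UNIV. sqrt (w e) * ?A (h e - H e) $ e)"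
  have S_eq: "S = (\<Sum>u\<in>U. \<Sum>e\<in>UNIV. u $ e * (u \<bullet> b e))"
  proof -
    have "?A (H e) $ e = (\<Sum>u\<in>U. (u \<bullet> ?A (h e)) * u $ e)" for e
    proof -
      have "u \<bullet> ?A (H e) = u \<bullet> ?A (h e)" if "u \<in> U" for u
        using W_orth[of u "h e - H e"] that U(1) diffV0[of e]
        by (auto simp: linear_diff[OF linear_weighted_slopes] inner_diff_right)
      then have "?A (H e) = (\<Sum>u\<in>U. (u \<bullet> ?A (h e)) *\<^sub>R u)"
        using expand[OF finU U(2,3), of "?A (H e)"] AHW U(6) by simp
      then show ?thesis by simp
    qed
    then have "S = (\<Sum>e\<in>UNIV. \<Sum>u\<in>U. u $ e * (u \<bullet> b e))"
      unfolding S_def b_def by (simp add: sum_distrib_left mult_ac)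
    then show ?thesis by (simp add: sum.swap[of _ U])
  qed
  have T_eq: "T = (\<Sum>z\<in>Z. \<Sum>e\<in>UNIV. z $ e * (z \<bullet> b e))"
  proof -
    have "?A (h e - H e) $ e = (\<Sum>z\<in>Z. (z \<bullet> ?A (h e)) * z $ e)" for e
    proof -
      have "z \<bullet> ?A (h e - H e) = z \<bullet> ?A (h e)" if zZ: "z \<in> Z" for z
      proof -
        obtain g where "g \<in> ?V0" "z = ?A g" using zZ Z(1) by blast
        then have "z \<bullet> ?A (H e) = 0" using W_orth[OF AHW] by (simp add: inner_commute)
        then show ?thesis by (simp add: linear_diff[OF linear_weighted_slopes] inner_diff_right)
      qed
      then have "?A (h e - H e) = (\<Sum>z\<in>Z. (z \<bullet> ?A (h e)) *\<^sub>R z)"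
        using expand[OF finZ Z(2,3), of "?A (h e - H e)"] diffV0[of e] Z(6) by auto
      then have "?A (h e - H e) $ e = (\<Sum>z\<in>Z. (z \<bullet> ?A (h e)) *\<^sub>R z) $ e" by (rule arg_cong)
      then show ?thesis by simp
    qed
    then have "T = (\<Sum>e\<in>UNIV. \<Sum>u\<in>Z. u $ e * (u \<bullet> b e))"
      unfolding T_def b_def by (simp add: sum_distrib_left mult_ac)
    then show ?thesis by (simp add: sum.swap[of _ Z])
  qed
  have ST: "S + T \<le> 1"
  proof -
    have "S + T = (\<Sum>e\<in>UNIV. sqrt (w e) * ?A (h e) $ e)"
      unfolding S_def T_def by (simp add: linear_diff[OF linear_weighted_slopes] sum.distrib[symmetric] algebra_simps)
    also have "\<dots> = (\<Sum>e\<in>UNIV. w e * ((h e $ fst e - h e $ snd e) / d (fst e) (snd e)))"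
      unfolding weighted_slopes_def vec_lambda_beta using w by (simp only: sqrt_mult_self_weight)
    also have "\<dots> \<le> (\<Sum>e\<in>UNIV. w e * 1)"
      using slope by (intro sum_mono mult_left_mono w) (meson abs_le_D1 abs_square_le_1)
    finally show ?thesis using w by simp
  qed
  have S_p: "(\<Sum>e\<in>UNIV. w e * (p (\<phi> (fst e) - \<phi> (snd e)) / d (fst e) (snd e))) = S"
  proof -
    have "p (\<phi> (fst e) - \<phi> (snd e)) = H e $ fst e - H e $ snd e" for e
    proof -
      have "a e \<bullet> \<phi> i = H e $ i" for i
      proof -
        have "a e \<bullet> \<phi> i = (\<Sum>k\<in>UNIV. if k \<in> J then a e $ k * \<Phi> k $ i else 0)"
          unfolding inner_vec_def \<phi>_def by (intro sum.cong) auto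
        also have "\<dots> = (\<Sum>k\<in>J. a e $ k * \<Phi> k $ i)" by (simp add: sum.If_cases)
        also have "\<dots> = H e $ i" unfolding H_def using hJ by simp
        finally show ?thesis .
      qed
      then show ?thesis using a_eq[of e] by (simp add: inner_diff_right)
    qed
    then show ?thesis unfolding S_def weighted_slopes_def vec_lambda_beta
      using w by (simp only: sqrt_mult_self_weight)
  qed
  have "S\<^sup>2 / (real (card J) - 1) + T\<^sup>2 / (real (CARD('m)) - real (card J)) \<le> 1"
    unfolding S_eq T_eq
    using U(3,5) Z(3,5) dimW dimZ cJ J by (intro trace) (auto simp: of_nat_diff)
  then have "S\<^sup>2 / (real (card J) - 1) + ((S + T) - S)\<^sup>2 / (real (CARD('m)) - real (card J)) \<le> 1" by simp
  from le_projection_bound[OF _ _ ST this] J cJ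
  have "S \<le> projection_bound (real (card J) - 1) (real (CARD('m)) - 1)" by (simp add: algebra_simps)
  then show ?thesis using adm S_p J cJ by (auto simp: of_nat_diff)
qed

text \<open>
  The vectors dominating the stretches of some extension form a convex set that is closed upwards. If
  the constant vector \<open>K\<close> were not in it, a separating hyperplane would have nonnegative
  coefficients; normalized, these would be weights for which every extension has mean stretch at least
  \<open>K\<close>, contrary to the bound for weighted means.
\<close>

lemma affine_extension_bound:
  fixes d :: "'m::finite \<Rightarrow> 'm \<Rightarrow> real" and p :: "real^'m \<Rightarrow> real"
  assumes d: "pseudometric d" and p: "seminorm p"
    and J: "2 \<le> card J" "J \<noteq> UNIV"
    and sep: "\<And>x y. x \<in> J \<Longrightarrow> y \<in> J \<Longrightarrow> x \<noteq> y \<Longrightarrow> d x y \<noteq> 0"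
    and pJ: "\<And>x y. x \<in> J \<Longrightarrow> y \<in> J \<Longrightarrow> p (axis x 1 - axis y 1) \<le> d x y"
    and K: "projection_bound (card J - 1) (CARD('m) - 1) < K"
  shows "\<exists>\<phi>. affine_extension d J \<phi> \<and> (\<forall>i j. p (\<phi> i - \<phi> j) \<le> K * d i j)"
proof -
  define slope where
    "slope \<phi> e = p (\<phi> (fst e) - \<phi> (snd e)) / d (fst e) (snd e)" for \<phi> :: "'m \<Rightarrow> real^'m" and e
  define D where "D = {v :: real^('m\<times>'m). \<exists>\<phi>. affine_extension d J \<phi> \<and> (\<forall>e. slope \<phi> e \<le> v $ e)}"
  have dnn: "0 \<le> d i j" for i j using d by (simp add: pseudometric_def)
  have slope_convex: "slope (\<lambda>i. u *\<^sub>R \<phi> i + v *\<^sub>R \<psi> i) e \<le> u * slope \<phi> e + v * slope \<psi> e"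
    if uv: "0 \<le> u" "0 \<le> v" for u v \<phi> \<psi> e
  proof -
    have "p (u *\<^sub>R (\<phi> (fst e) - \<phi> (snd e)) + v *\<^sub>R (\<psi> (fst e) - \<psi> (snd e)))
        \<le> u * p (\<phi> (fst e) - \<phi> (snd e)) + v * p (\<psi> (fst e) - \<psi> (snd e))"
      by (rule seminorm_convex[OF p uv])
    also have "u *\<^sub>R (\<phi> (fst e) - \<phi> (snd e)) + v *\<^sub>R (\<psi> (fst e) - \<psi> (snd e))
        = (u *\<^sub>R \<phi> (fst e) + v *\<^sub>R \<psi> (fst e)) - (u *\<^sub>R \<phi> (snd e) + v *\<^sub>R \<psi> (snd e))"
      by (simp add: algebra_simps)
    finally show ?thesis
      using dnn[of "fst e" "snd e"] unfolding slope_def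
      by (simp add: add_divide_distrib[symmetric] divide_right_mono)
  qed
  have aff_convex: "affine_extension d J (\<lambda>i. u *\<^sub>R \<phi> i + v *\<^sub>R \<psi> i)"
    if "affine_extension d J \<phi>" "affine_extension d J \<psi>" "u + v = 1" for u v :: real and \<phi> \<psi>
    unfolding affine_extension_def
  proof (intro conjI ballI allI impI)
    fix x assume "x \<in> J"
    then have "\<phi> x = axis x 1" "\<psi> x = axis x 1" using that(1,2) by (auto simp: affine_extension_def)
    then show "u *\<^sub>R \<phi> x + v *\<^sub>R \<psi> x = axis x 1"
      using that(3) by (simp add: scaleR_add_left[symmetric])
  next
    fix i k assume "k \<notin> J"
    then show "(u *\<^sub>R \<phi> i + v *\<^sub>R \<psi> i) $ k = 0" using that(1,2) by (simp add: affine_extension_def)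
  next
    fix i j assume "d i j = 0"
    then have "\<phi> i = \<phi> j" "\<psi> i = \<psi> j" using that(1,2) unfolding affine_extension_def by blast+
    then show "u *\<^sub>R \<phi> i + v *\<^sub>R \<psi> i = u *\<^sub>R \<phi> j + v *\<^sub>R \<psi> j" by simp
  qed
  have "convex D"
  proof (rule convexI)
    fix x y u v assume xy: "x \<in> D" "y \<in> D" and uv: "0 \<le> u" "0 \<le> v" "u + v = (1::real)"
    from xy(1) obtain \<phi> where \<phi>: "affine_extension d J \<phi>" "\<And>e. slope \<phi> e \<le> x $ e" by (auto simp: D_def)
    from xy(2) obtain \<psi> where \<psi>: "affine_extension d J \<psi>" "\<And>e. slope \<psi> e \<le> y $ e" by (auto simp: D_def)
    have "slope (\<lambda>i. u *\<^sub>R \<phi> i + v *\<^sub>R \<psi> i) e \<le> (u *\<^sub>R x + v *\<^sub>R y) $ e" for e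
      using slope_convex[OF uv(1,2), of \<phi> \<psi> e] mult_left_mono[OF \<phi>(2)[of e] uv(1)]
        mult_left_mono[OF \<psi>(2)[of e] uv(2)] by simp
    then show "u *\<^sub>R x + v *\<^sub>R y \<in> D" using aff_convex[OF \<phi>(1) \<psi>(1) uv(3)] unfolding D_def by blast
  qed
  have "(\<chi> e. K) \<in> D"
  proof (rule ccontr)
    assume notin: "(\<chi> e. K) \<notin> D"
    define w0 :: "'m \<times> 'm \<Rightarrow> real" where "w0 e = 1 / CARD('m \<times> 'm)" for e
    have "sum w0 UNIV = 1" by (simp add: w0_def)
    then obtain \<phi>0 where \<phi>0: "affine_extension d J \<phi>0"
      using weighted_extension_bound[OF d p J sep pJ, of w0] by (auto simp: w0_def)
    then have in_D: "(\<chi> e. slope \<phi>0 e) \<in> D" unfolding D_def by auto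
    then have "D \<noteq> {}" by auto
    then obtain a c where a: "a \<noteq> 0" and aK: "a \<bullet> (\<chi> e. K) \<le> c" and aD: "\<And>v. v \<in> D \<Longrightarrow> c \<le> a \<bullet> v"
      using separating_hyperplane_sets[of "{\<chi> e. K}" D] \<open>convex D\<close> notin by auto
    have a_nn: "0 \<le> a $ e" for e
    proof (rule ccontr)
      assume neg: "\<not> 0 \<le> a $ e"
      define v0 where "v0 = (\<chi> e. slope \<phi>0 e)"
      define t where "t = (\<bar>a \<bullet> v0 - c\<bar> + 1) / (- a $ e)"
      have t: "0 \<le> t" using neg by (simp add: t_def divide_nonneg_neg)
      have "slope \<phi>0 e' \<le> (v0 + t *\<^sub>R axis e 1) $ e'" for e' using t by (auto simp: v0_def axis_def)
      then have "v0 + t *\<^sub>R axis e 1 \<in> D" using \<phi>0 unfolding D_def by blast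
      from aD[OF this] have "c \<le> a \<bullet> v0 + t * a $ e" by (simp add: inner_add_right inner_axis)
      also have "t * a $ e = - (\<bar>a \<bullet> v0 - c\<bar> + 1)" using neg by (simp add: t_def)
      finally show False by linarith
    qed
    define s where "s = (\<Sum>e\<in>UNIV. a $ e)"
    have s: "0 < s"
    proof -
      obtain e where "a $ e \<noteq> 0" using a by (auto simp: vec_eq_iff)
      then have "0 < a $ e" using a_nn[of e] by simp
      also have "a $ e \<le> s" unfolding s_def by (rule member_le_sum) (auto simp: a_nn)
      finally show ?thesis .
    qed
    have "\<exists>\<phi>. affine_extension d J \<phi> \<and>
       (\<Sum>e\<in>UNIV. a $ e / s * (p (\<phi> (fst e) - \<phi> (snd e)) / d (fst e) (snd e)))
         \<le> projection_bound (card J - 1) (CARD('m) - 1)"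
    proof (rule weighted_extension_bound[OF d p J sep pJ])
      show "0 \<le> a $ e / s" for e using a_nn s by simp
      show "(\<Sum>e\<in>UNIV. a $ e / s) = 1" using s by (simp add: sum_divide_distrib[symmetric] s_def)
    qed
    then obtain \<phi> where \<phi>: "affine_extension d J \<phi>"
      and le: "(\<Sum>e\<in>UNIV. a $ e / s * slope \<phi> e) \<le> projection_bound (card J - 1) (CARD('m) - 1)"
      unfolding slope_def by blast
    have "(\<chi> e. slope \<phi> e) \<in> D" using \<phi> unfolding D_def by auto
    from aD[OF this] aK have "a \<bullet> (\<chi> e. K) \<le> a \<bullet> (\<chi> e. slope \<phi> e)" by linarith
    then have "K * s \<le> (\<Sum>e\<in>UNIV. a $ e * slope \<phi> e)"
      by (simp add: inner_vec_def s_def sum_distrib_left mult.commute)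
    also have "\<dots> = s * (\<Sum>e\<in>UNIV. a $ e / s * slope \<phi> e)" using s by (simp add: sum_distrib_left)
    also have "\<dots> \<le> s * projection_bound (card J - 1) (CARD('m) - 1)"
      using le s by (intro mult_left_mono) auto
    also have "\<dots> < s * K" using K s by simp
    finally show False by (simp add: mult.commute)
  qed
  then obtain \<phi> where \<phi>: "affine_extension d J \<phi>" and sl: "\<And>e. slope \<phi> e \<le> K" by (auto simp: D_def)
  have "p (\<phi> i - \<phi> j) \<le> K * d i j" for i j
  proof (cases "d i j = 0")
    case True
    then have "\<phi> i = \<phi> j" using \<phi> by (simp add: affine_extension_def)
    then show ?thesis using True seminorm_zero[OF p] by simp
  next
    case False
    then show ?thesis using sl[of "(i, j)"] dnn[of i j] by (simp add: slope_def field_simps)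
  qed
  then show ?thesis using \<phi> by blast
qed

section \<open>Four points in the plane\<close>

definition l1_dist :: "real \<times> real \<Rightarrow> real \<times> real \<Rightarrow> real" where
  "l1_dist z z' = \<bar>fst z - fst z'\<bar> + \<bar>snd z - snd z'\<bar>"

lemma l1_dist_triangle: "l1_dist x z \<le> l1_dist x y + l1_dist y z"
  by (simp add: l1_dist_def)

lemma l1_dist_commute: "l1_dist x y = l1_dist y x"
  by (simp add: l1_dist_def abs_minus_commute)

lemma l1_dist_eq_0: "l1_dist x y = 0 \<longleftrightarrow> x = y"
  by (auto simp: l1_dist_def prod_eq_iff)

lemma l1_dist_nonneg: "0 \<le> l1_dist x y"
  by (simp add: l1_dist_def)

definition clamp0 :: "real \<Rightarrow> real \<Rightarrow> real" where
  "clamp0 m s = max 0 (min s m)"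

definition ramp :: "real \<Rightarrow> real \<Rightarrow> real" where
  "ramp m s = clamp0 m s / m"

lemma ramp_le: "s \<le> 0 \<Longrightarrow> ramp m s = 0"
  by (simp add: ramp_def clamp0_def max_def min_def)

lemma ramp_ge: "0 < m \<Longrightarrow> m \<le> s \<Longrightarrow> ramp m s = 1"
  by (simp add: ramp_def clamp0_def)

lemma ramp_degenerate: "ramp 0 s = 0"
  by (simp add: ramp_def)

lemma ramp_bounds: "0 \<le> m \<Longrightarrow> 0 \<le> ramp m s \<and> ramp m s \<le> 1"
  by (auto simp: ramp_def clamp0_def divide_le_eq_1)

lemma ramp_diff: "0 \<le> m \<Longrightarrow> \<bar>ramp m s - ramp m s'\<bar> * m = \<bar>clamp0 m s - clamp0 m s'\<bar>"
  by (cases "m = 0") (auto simp: ramp_def clamp0_def diff_divide_distrib[symmetric] abs_divide)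

text \<open>
  A point moving along the line passes the intervals \<open>[-l, 0]\<close>, \<open>[0, a]\<close> and \<open>[a, a + l']\<close> one after
  the other, and each of the three terms measures the movement within one of them.
\<close>

lemma clamp0_diffs:
  assumes "0 \<le> a" "0 \<le> l" "0 \<le> l'"
  shows "\<bar>clamp0 a s - clamp0 a s'\<bar> + \<bar>clamp0 l (- s) - clamp0 l (- s')\<bar>
       + \<bar>clamp0 l' (s - a) - clamp0 l' (s' - a)\<bar> \<le> \<bar>s - s'\<bar>"
proof -
  have *: "\<bar>clamp0 a s - clamp0 a s'\<bar> + \<bar>clamp0 l (- s) - clamp0 l (- s')\<bar>
       + \<bar>clamp0 l' (s - a) - clamp0 l' (s' - a)\<bar> \<le> s' - s" if "s \<le> s'" for s s'
  proof -
    have total: "clamp0 a r - clamp0 l (- r) + clamp0 l' (r - a) = max (- l) (min r (a + l'))" for r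
      using assms unfolding clamp0_def max_def min_def by auto
    have "clamp0 a s \<le> clamp0 a s'" "clamp0 l (- s') \<le> clamp0 l (- s)"
      "clamp0 l' (s - a) \<le> clamp0 l' (s' - a)"
      using that by (auto simp: clamp0_def)
    moreover have "max (- l) (min s' (a + l')) - max (- l) (min s (a + l')) \<le> s' - s"
      using that unfolding max_def min_def by auto
    ultimately show ?thesis using total[of s] total[of s'] by linarith
  qed
  show ?thesis
    using *[of s s'] *[of s' s] by (cases "s \<le> s'") (auto simp: abs_minus_commute)
qed

text \<open>
  Antennas of lengths \<open>l i\<close> at the corners of the rectangle \<open>[0, a] \<times> [0, b]\<close>. They point to the left,
  down, to the right and up, in this order. Between any two tips there is then a path along antennas and
  sides that is monotone in both coordinates, and its length is their \<open>l1\<close> distance.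
\<close>

locale pinwheel =
  fixes a b :: real and l :: "4 \<Rightarrow> real"
  assumes a: "0 \<le> a" and b: "0 \<le> b" and l: "\<And>i. 0 \<le> l i"
begin

definition tip :: "4 \<Rightarrow> real \<times> real" where
  "tip i = (if i = 1 then (- l 1, 0) else if i = 2 then (a, - l 2)
     else if i = 3 then (a + l 3, b) else (0, b + l 4))"

definition corner :: "4 \<Rightarrow> real \<times> real" where
  "corner i = (if i = 1 then (0, 0) else if i = 2 then (a, 0) else if i = 3 then (a, b) else (0, b))"

lemma tip_corner: "l1_dist (tip i) (corner i) = l i"
  using exhaust_4[of i] l[of i] by (auto simp: tip_def corner_def l1_dist_def)

text \<open>
  The extension is the sum of a bilinear interpolation on the rectangle and of one term for each
  antenna, which depends on one coordinate only. Moving horizontally one changes either the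
  bilinear part or the term of one of the two horizontal antennas, at a rate of at most \<open>K\<close>, and
  likewise vertically; in the \<open>l1\<close> metric this suffices.
\<close>

lemma extend_from_vertices:
  fixes p :: "'v::real_vector \<Rightarrow> real" and x c :: "4 \<Rightarrow> 'v"
  assumes p: "seminorm p" and K: "0 \<le> K"
    and xc: "\<And>i. p (x i - c i) \<le> K * l1_dist (tip i) (corner i)"
    and cc: "\<And>i j. p (c i - c j) \<le> K * l1_dist (corner i) (corner j)"
    and xc0: "\<And>i. tip i = corner i \<Longrightarrow> x i = c i"
    and cc0: "\<And>i j. corner i = corner j \<Longrightarrow> c i = c j"
  obtains \<gamma> where "\<And>i. \<gamma> (tip i) = x i" and "\<And>z z'. p (\<gamma> z - \<gamma> z') \<le> K * l1_dist z z'"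
proof -
  define B where "B r q = ((1 - r) * (1 - q)) *\<^sub>R c 1 + (r * (1 - q)) *\<^sub>R c 2
      + (r * q) *\<^sub>R c 3 + ((1 - r) * q) *\<^sub>R c 4" for r q :: real
  define G where "G s t = B (ramp a s) (ramp b t)
     + ramp (l 1) (- s) *\<^sub>R (x 1 - c 1) + ramp (l 3) (s - a) *\<^sub>R (x 3 - c 3)
     + ramp (l 2) (- t) *\<^sub>R (x 2 - c 2) + ramp (l 4) (t - b) *\<^sub>R (x 4 - c 4)" for s t
  define \<gamma> where "\<gamma> z = G (fst z) (snd z)" for z
  have xc': "p (x i - c i) \<le> K * l i" for i using xc[of i] by (simp add: tip_corner)
  have edges: "p (c 2 - c 1) \<le> K * a" "p (c 3 - c 4) \<le> K * a" "p (c 4 - c 1) \<le> K * b" "p (c 3 - c 2) \<le> K * b"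
    using cc[of 2 1] cc[of 3 4] cc[of 4 1] cc[of 3 2] a b by (simp_all add: corner_def l1_dist_def)
  have mix: "p ((1 - r) *\<^sub>R u + r *\<^sub>R v) \<le> M" if "0 \<le> r \<and> r \<le> 1" "p u \<le> M" "p v \<le> M" for r u v M
  proof -
    have "p ((1 - r) *\<^sub>R u + r *\<^sub>R v) \<le> (1 - r) * p u + r * p v"
      using that by (intro seminorm_convex[OF p]) auto
    also have "\<dots> \<le> (1 - r) * M + r * M" using that by (intro add_mono mult_left_mono) auto
    finally show ?thesis by (simp add: algebra_simps)
  qed
  have three: "p (\<alpha> *\<^sub>R u + \<beta> *\<^sub>R v + \<delta> *\<^sub>R w) \<le> K * (\<bar>\<alpha>\<bar> * m + \<bar>\<beta>\<bar> * m' + \<bar>\<delta>\<bar> * m'')"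
    if "p u \<le> K * m" "p v \<le> K * m'" "p w \<le> K * m''" for \<alpha> \<beta> \<delta> m m' m'' u v w
  proof -
    have "p (\<alpha> *\<^sub>R u + \<beta> *\<^sub>R v + \<delta> *\<^sub>R w) \<le> p (\<alpha> *\<^sub>R u) + p (\<beta> *\<^sub>R v) + p (\<delta> *\<^sub>R w)"
      using seminorm_add[OF p, of "\<alpha> *\<^sub>R u + \<beta> *\<^sub>R v" "\<delta> *\<^sub>R w"] seminorm_add[OF p, of "\<alpha> *\<^sub>R u" "\<beta> *\<^sub>R v"]
      by linarith
    also have "\<dots> \<le> \<bar>\<alpha>\<bar> * (K * m) + \<bar>\<beta>\<bar> * (K * m') + \<bar>\<delta>\<bar> * (K * m'')"
      unfolding seminorm_scale[OF p] using that by (intro add_mono mult_left_mono) auto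
    finally show ?thesis by (simp add: algebra_simps)
  qed
  have horizontal: "p (G s t - G s' t) \<le> K * \<bar>s - s'\<bar>" for s s' t
  proof -
    have "G s t - G s' t = (ramp a s - ramp a s') *\<^sub>R ((1 - ramp b t) *\<^sub>R (c 2 - c 1) + ramp b t *\<^sub>R (c 3 - c 4))
       + (ramp (l 1) (- s) - ramp (l 1) (- s')) *\<^sub>R (x 1 - c 1)
       + (ramp (l 3) (s - a) - ramp (l 3) (s' - a)) *\<^sub>R (x 3 - c 3)"
      by (simp add: G_def B_def algebra_simps)
    also have "p \<dots> \<le> K * (\<bar>ramp a s - ramp a s'\<bar> * a + \<bar>ramp (l 1) (- s) - ramp (l 1) (- s')\<bar> * l 1
        + \<bar>ramp (l 3) (s - a) - ramp (l 3) (s' - a)\<bar> * l 3)"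
      by (intro three mix ramp_bounds b edges xc')
    also have "\<dots> \<le> K * \<bar>s - s'\<bar>"
      unfolding ramp_diff[OF a] ramp_diff[OF l] by (intro mult_left_mono clamp0_diffs a l K)
    finally show ?thesis .
  qed
  have vertical: "p (G s t - G s t') \<le> K * \<bar>t - t'\<bar>" for s t t'
  proof -
    have "G s t - G s t' = (ramp b t - ramp b t') *\<^sub>R ((1 - ramp a s) *\<^sub>R (c 4 - c 1) + ramp a s *\<^sub>R (c 3 - c 2))
       + (ramp (l 2) (- t) - ramp (l 2) (- t')) *\<^sub>R (x 2 - c 2)
       + (ramp (l 4) (t - b) - ramp (l 4) (t' - b)) *\<^sub>R (x 4 - c 4)"
      by (simp add: G_def B_def algebra_simps)
    also have "p \<dots> \<le> K * (\<bar>ramp b t - ramp b t'\<bar> * b + \<bar>ramp (l 2) (- t) - ramp (l 2) (- t')\<bar> * l 2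
        + \<bar>ramp (l 4) (t - b) - ramp (l 4) (t' - b)\<bar> * l 4)"
      by (intro three mix ramp_bounds a edges xc')
    also have "\<dots> \<le> K * \<bar>t - t'\<bar>"
      unfolding ramp_diff[OF b] ramp_diff[OF l] by (intro mult_left_mono clamp0_diffs b l K)
    finally show ?thesis .
  qed
  show ?thesis
  proof (rule that[of \<gamma>])
    show "p (\<gamma> z - \<gamma> z') \<le> K * l1_dist z z'" for z z'
    proof -
      have "\<gamma> z - \<gamma> z' = (G (fst z) (snd z) - G (fst z') (snd z)) + (G (fst z') (snd z) - G (fst z') (snd z'))"
        by (simp add: \<gamma>_def)
      then have "p (\<gamma> z - \<gamma> z') \<le> p (G (fst z) (snd z) - G (fst z') (snd z)) + p (G (fst z') (snd z) - G (fst z') (snd z'))"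
        by (metis seminorm_add[OF p])
      also have "\<dots> \<le> K * \<bar>fst z - fst z'\<bar> + K * \<bar>snd z - snd z'\<bar>"
        by (intro add_mono horizontal vertical)
      finally show ?thesis by (simp add: l1_dist_def algebra_simps)
    qed
    have c12: "a = 0 \<Longrightarrow> c 1 = c 2" "a = 0 \<Longrightarrow> c 3 = c 4" "b = 0 \<Longrightarrow> c 1 = c 4" "b = 0 \<Longrightarrow> c 2 = c 3"
      using cc0[of 1 2] cc0[of 3 4] cc0[of 1 4] cc0[of 2 3] unfolding corner_def by auto
    have xl: "l i = 0 \<Longrightarrow> x i = c i" for i
      using tip_corner[of i] by (intro xc0) (simp add: l1_dist_eq_0)
    have rl: "ramp (l i) (l i) *\<^sub>R (x i - c i) = x i - c i" for i
      using xl[of i] l[of i] by (cases "l i = 0") (auto simp: ramp_ge)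
    have edge_end: "B (ramp a a) 0 = c 2" "B (ramp a a) (ramp b b) = c 3" "B 0 (ramp b b) = c 4"
      "B 0 0 = c 1"
      using a b c12 by (cases "a = 0"; cases "b = 0"; simp add: B_def ramp_ge ramp_degenerate)+
    have clip: "ramp a (a + l 3) = ramp a a" "ramp b (b + l 4) = ramp b b"
      using a b l by (auto simp: ramp_def clamp0_def)
    show "\<gamma> (tip i) = x i" for i
      using exhaust_4[of i] a b l[of 1] l[of 2] l[of 3] l[of 4]
      by (auto simp: \<gamma>_def G_def tip_def ramp_le edge_end rl clip)
  qed
qed

end

text \<open>
  Rectangle and antennas form the injective hull of the four points. The six numbers \<open>a\<close>, \<open>b\<close> and
  \<open>l i\<close> are the solution of the six linear equations for the distances between the tips; the assumptions on
  the largest sum of opposite distances make \<open>a\<close> and \<open>b\<close> nonnegative, and the triangle inequalities do the same for \<open>l\<close>.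
\<close>

lemma four_points_in_plane:
  fixes D :: "4 \<Rightarrow> 4 \<Rightarrow> real"
  assumes D: "pseudometric D"
    and max: "D 1 2 + D 3 4 \<le> D 1 3 + D 2 4" "D 1 4 + D 2 3 \<le> D 1 3 + D 2 4"
  obtains a b l where "pinwheel a b l" and "\<And>i j. l1_dist (pinwheel.tip a b l i) (pinwheel.tip a b l j) = D i j"
proof -
  define a where "a = (D 1 3 + D 2 4 - D 1 4 - D 2 3) / 2"
  define b where "b = (D 1 3 + D 2 4 - D 1 2 - D 3 4) / 2"
  define l :: "4 \<Rightarrow> real" where
    "l i = (if i = 1 then (D 1 2 + D 1 4 - D 2 4) / 2 else if i = 2 then (D 1 2 + D 2 3 - D 1 3) / 2
      else if i = 3 then (D 2 3 + D 3 4 - D 2 4) / 2 else (D 1 4 + D 3 4 - D 1 3) / 2)" for i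
  have sym: "D i j = D j i" and tri: "D i k \<le> D i j + D j k" and refl: "D i i = 0" for i j k
    using D unfolding pseudometric_def by blast+
  have "0 \<le> a" "0 \<le> b" using max by (auto simp: a_def b_def)
  moreover have "0 \<le> l i" for i
    using tri[of 2 4 1] tri[of 1 3 2] tri[of 2 4 3] tri[of 1 3 4] sym[of 2 1] sym[of 4 3]
    by (auto simp: l_def)
  ultimately interpret P: pinwheel a b l by unfold_locales
  have "l1_dist (P.tip i) (P.tip j) = D i j" if "(i, j) \<in> {(1,2), (1,3), (1,4), (2,3), (2,4), (3,4)}" for i j
  proof -
    note nn = \<open>0 \<le> a\<close> \<open>0 \<le> b\<close> P.l[of 1] P.l[of 2] P.l[of 3] P.l[of 4]
    have "l1_dist (P.tip 1) (P.tip 2) = l 1 + a + l 2" "l1_dist (P.tip 1) (P.tip 3) = l 1 + a + l 3 + b"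
      "l1_dist (P.tip 1) (P.tip 4) = l 1 + b + l 4" "l1_dist (P.tip 2) (P.tip 3) = l 2 + b + l 3"
      "l1_dist (P.tip 2) (P.tip 4) = l 2 + a + b + l 4" "l1_dist (P.tip 3) (P.tip 4) = l 3 + a + l 4"
      using nn by (simp_all add: P.tip_def l1_dist_def)
    with that show ?thesis by (auto simp: a_def b_def l_def field_simps)
  qed
  then have "l1_dist (P.tip i) (P.tip j) = D i j" for i j
    using exhaust_4[of i] exhaust_4[of j] sym refl l1_dist_commute l1_dist_eq_0
    by (smt (verit, best) insertI1 insertI2)
  with P.pinwheel_axioms show ?thesis by (rule that)
qed

text \<open>
  \<open>\<gamma>\<close> sends a point of the plane to the coefficients with which its image is to be combined from the
  images of the four given points; \<open>p\<close> will be the norm of such a combination.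
\<close>

lemma four_point_extension:
  fixes D :: "4 \<Rightarrow> 4 \<Rightarrow> real" and p :: "real^4 \<Rightarrow> real"
  assumes D: "pseudometric D" and ne: "\<And>i j. i \<noteq> j \<Longrightarrow> D i j \<noteq> 0"
    and max: "D 1 2 + D 3 4 \<le> D 1 3 + D 2 4" "D 1 4 + D 2 3 \<le> D 1 3 + D 2 4"
    and p: "seminorm p" and pD: "\<And>i j. p (axis i 1 - axis j 1) \<le> D i j"
    and K: "(3 + 6 * sqrt 2) / 7 < K"
  obtains pos \<gamma> where "\<And>i j. l1_dist (pos i) (pos j) = D i j" and "\<And>i. \<gamma> (pos i) = axis i 1"
    and "\<And>z z'. p (\<gamma> z - \<gamma> z') \<le> K * l1_dist z z'"
proof -
  obtain a b l where "pinwheel a b l"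
    and iso: "\<And>i j. l1_dist (pinwheel.tip a b l i) (pinwheel.tip a b l j) = D i j"
    using four_points_in_plane[OF D max] by metis
  interpret P: pinwheel a b l by fact
  define pos where "pos = case_sum P.tip P.corner"
  define d where "d i j = l1_dist (pos i) (pos j)" for i j
  define \<pi> where "\<pi> v = (\<chi> i. v $ Inl i)" for v :: "real^(4+4)"
  define J :: "(4 + 4) set" where "J = range Inl"
  have \<pi>_diff: "\<pi> (u - v) = \<pi> u - \<pi> v" for u v by (simp add: \<pi>_def vec_eq_iff)
  have \<pi>_axis: "\<pi> (axis (Inl i) 1) = axis i 1" for i by (simp add: \<pi>_def vec_eq_iff axis_def)
  have d: "pseudometric d"
    unfolding pseudometric_def d_def
    using l1_dist_triangle l1_dist_commute l1_dist_eq_0 l1_dist_nonneg by blast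
  have p\<pi>: "seminorm (p \<circ> \<pi>)"
  proof -
    have "\<pi> (u + v) = \<pi> u + \<pi> v" "\<pi> (c *\<^sub>R v) = c *\<^sub>R \<pi> v" for u v c by (simp_all add: \<pi>_def vec_eq_iff)
    then show ?thesis using p by (simp add: seminorm_def)
  qed
  have cardJ: "card J = 4" by (simp add: J_def card_image)
  have "Inr 1 \<notin> J" by (auto simp: J_def)
  then have "J \<noteq> UNIV" by blast
  have cards: "real (card J - 1) = 3" "real (CARD(4+4) - 1) = 7" using cardJ by simp_all
  have "\<exists>\<phi>. affine_extension d J \<phi> \<and> (\<forall>i j. (p \<circ> \<pi>) (\<phi> i - \<phi> j) \<le> K * d i j)"
  proof (rule affine_extension_bound[OF d p\<pi> _ \<open>J \<noteq> UNIV\<close>])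
    show "2 \<le> card J" using cardJ by simp
    show "d x y \<noteq> 0" if "x \<in> J" "y \<in> J" "x \<noteq> y" for x y
      using that ne by (auto simp: J_def d_def pos_def iso)
    show "(p \<circ> \<pi>) (axis x 1 - axis y 1) \<le> d x y" if "x \<in> J" "y \<in> J" for x y
      using that pD by (auto simp: J_def d_def pos_def iso \<pi>_diff \<pi>_axis)
    show "projection_bound (real (card J - 1)) (real (CARD(4 + 4) - 1)) < K"
      unfolding cards projection_bound_3_7 by (rule K)
  qed
  then obtain \<phi> where \<phi>: "affine_extension d J \<phi>" and lip: "\<And>i j. p (\<pi> (\<phi> i - \<phi> j)) \<le> K * d i j" by auto
  have \<phi>J: "\<phi> (Inl i) = axis (Inl i) 1" for i using \<phi> by (auto simp: affine_extension_def J_def)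
  have \<phi>0: "pos i = pos j \<Longrightarrow> \<phi> i = \<phi> j" for i j
    using \<phi> unfolding affine_extension_def d_def l1_dist_eq_0 by blast
  have K0: "0 \<le> K" using K by (smt (verit) divide_nonneg_nonneg real_sqrt_ge_zero)
  obtain \<gamma> where "\<And>i. \<gamma> (P.tip i) = \<pi> (\<phi> (Inl i))" and "\<And>z z'. p (\<gamma> z - \<gamma> z') \<le> K * l1_dist z z'"
  proof (rule P.extend_from_vertices[OF p K0, of "\<lambda>i. \<pi> (\<phi> (Inl i))" "\<lambda>i. \<pi> (\<phi> (Inr i))"])
    show "p (\<pi> (\<phi> (Inl i)) - \<pi> (\<phi> (Inr i))) \<le> K * l1_dist (P.tip i) (P.corner i)" for i
      using lip[of "Inl i" "Inr i"] by (simp add: \<pi>_diff d_def pos_def)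
    show "p (\<pi> (\<phi> (Inr i)) - \<pi> (\<phi> (Inr j))) \<le> K * l1_dist (P.corner i) (P.corner j)" for i j
      using lip[of "Inr i" "Inr j"] by (simp add: \<pi>_diff d_def pos_def)
    show "\<pi> (\<phi> (Inl i)) = \<pi> (\<phi> (Inr i))" if "P.tip i = P.corner i" for i
      using \<phi>0[of "Inl i" "Inr i"] that by (simp add: pos_def)
    show "\<pi> (\<phi> (Inr i)) = \<pi> (\<phi> (Inr j))" if "P.corner i = P.corner j" for i j
      using \<phi>0[of "Inr i" "Inr j"] that by (simp add: pos_def)
  qed blast
  then show ?thesis using that[of P.tip \<gamma>] iso by (simp add: \<phi>J \<pi>_axis)
qed

section \<open>The upper bound\<close>

lemma real_field_ring_simps [simp]:
  "carrier real_field_ring = UNIV" "add real_field_ring = (+)" "mult real_field_ring = (*)"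
  "one real_field_ring = 1" "zero real_field_ring = 0"
  by (simp_all add: real_field_ring_def)

text \<open>
  Completeness is kept apart: for the space in the lower bound it can only be proved once the norm is known
  to induce a metric.
\<close>

locale normed_module =
  module real_field_ring E for E :: "(real, 'b) module" (structure) +
  fixes N :: "'b \<Rightarrow> real"
  assumes N_nonneg: "v \<in> carrier E \<Longrightarrow> 0 \<le> N v"
    and N_eq_0: "v \<in> carrier E \<Longrightarrow> N v = 0 \<longleftrightarrow> v = \<zero>\<^bsub>E\<^esub>"
    and N_scale: "v \<in> carrier E \<Longrightarrow> N (c \<odot>\<^bsub>E\<^esub> v) = \<bar>c\<bar> * N v"
    and N_add: "u \<in> carrier E \<Longrightarrow> v \<in> carrier E \<Longrightarrow> N (u \<oplus>\<^bsub>E\<^esub> v) \<le> N u + N v"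

lemma Banach_space_iff:
  "Banach_space E N \<longleftrightarrow> normed_module E N \<and> mcomplete_of (norm_metric E N)"
  unfolding Banach_space_def normed_module_def normed_module_axioms_def by blast

context normed_module
begin

lemma minus_one_smult: "v \<in> carrier E \<Longrightarrow> (-1) \<odot>\<^bsub>E\<^esub> v = \<ominus>\<^bsub>E\<^esub> v"
proof -
  assume v: "v \<in> carrier E"
  have "(-1) \<odot>\<^bsub>E\<^esub> v \<oplus>\<^bsub>E\<^esub> v = (-1) \<odot>\<^bsub>E\<^esub> v \<oplus>\<^bsub>E\<^esub> 1 \<odot>\<^bsub>E\<^esub> v"
    using smult_one[OF v] by simp
  also have "\<dots> = (-1 + 1) \<odot>\<^bsub>E\<^esub> v" using smult_l_distr[of "-1" 1 v] v by simp
  also have "\<dots> = \<zero>\<^bsub>E\<^esub>" using smult_l_null[OF v] by simp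
  finally show ?thesis using v M.minus_equality[of "(-1) \<odot>\<^bsub>E\<^esub> v" v] by simp
qed

lemma N_minus: "v \<in> carrier E \<Longrightarrow> N (\<ominus>\<^bsub>E\<^esub> v) = N v"
  using N_scale[of v "-1"] by (simp add: minus_one_smult)

lemma minus_eq_0_iff: "u \<in> carrier E \<Longrightarrow> v \<in> carrier E \<Longrightarrow> u \<ominus>\<^bsub>E\<^esub> v = \<zero>\<^bsub>E\<^esub> \<longleftrightarrow> u = v"
proof -
  assume uv: "u \<in> carrier E" "v \<in> carrier E"
  then have "u = (u \<ominus>\<^bsub>E\<^esub> v) \<oplus>\<^bsub>E\<^esub> v" by (simp add: a_minus_def M.a_assoc M.l_neg)
  moreover have "v \<ominus>\<^bsub>E\<^esub> v = \<zero>\<^bsub>E\<^esub>" using uv by (simp add: a_minus_def M.r_neg)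
  ultimately show ?thesis using uv by (metis M.l_zero)
qed

lemma Metric_space_norm:
  "Metric_space (carrier E) (\<lambda>u v. if u \<in> carrier E \<and> v \<in> carrier E then N (u \<ominus>\<^bsub>E\<^esub> v) else 0)"
proof
  have swap: "u \<ominus>\<^bsub>E\<^esub> v = \<ominus>\<^bsub>E\<^esub> (v \<ominus>\<^bsub>E\<^esub> u)" if "u \<in> carrier E" "v \<in> carrier E" for u v
    using that by (simp add: a_minus_def M.minus_add M.a_comm)
  fix u v w
  show "0 \<le> (if u \<in> carrier E \<and> v \<in> carrier E then N (u \<ominus>\<^bsub>E\<^esub> v) else 0)"
    by (simp add: N_nonneg)
  show "(if u \<in> carrier E \<and> v \<in> carrier E then N (u \<ominus>\<^bsub>E\<^esub> v) else 0)
      = (if v \<in> carrier E \<and> u \<in> carrier E then N (v \<ominus>\<^bsub>E\<^esub> u) else 0)"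
    using swap[of u v] N_minus[of "v \<ominus>\<^bsub>E\<^esub> u"] by auto
  assume u: "u \<in> carrier E" and v: "v \<in> carrier E"
  show "((if u \<in> carrier E \<and> v \<in> carrier E then N (u \<ominus>\<^bsub>E\<^esub> v) else 0) = 0) = (u = v)"
    using u v by (simp add: N_eq_0 minus_eq_0_iff)
  assume w: "w \<in> carrier E"
  have "u \<ominus>\<^bsub>E\<^esub> w = (u \<ominus>\<^bsub>E\<^esub> v) \<oplus>\<^bsub>E\<^esub> (v \<ominus>\<^bsub>E\<^esub> w)"
    using u v w by (simp add: a_minus_def M.a_assoc[symmetric]) (simp add: M.a_assoc M.l_neg)
  then show "(if u \<in> carrier E \<and> w \<in> carrier E then N (u \<ominus>\<^bsub>E\<^esub> w) else 0)
      \<le> (if u \<in> carrier E \<and> v \<in> carrier E then N (u \<ominus>\<^bsub>E\<^esub> v) else 0)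
       + (if v \<in> carrier E \<and> w \<in> carrier E then N (v \<ominus>\<^bsub>E\<^esub> w) else 0)"
    using u v w N_add[of "u \<ominus>\<^bsub>E\<^esub> v" "v \<ominus>\<^bsub>E\<^esub> w"] by simp
qed

lemma mspace_norm_metric [simp]: "mspace (norm_metric E N) = carrier E"
  unfolding norm_metric_def by (rule Metric_space.mspace_metric[OF Metric_space_norm])

lemma mdist_norm_metric:
  "u \<in> carrier E \<Longrightarrow> v \<in> carrier E \<Longrightarrow> mdist (norm_metric E N) u v = N (u \<ominus>\<^bsub>E\<^esub> v)"
  unfolding norm_metric_def Metric_space.mdist_metric[OF Metric_space_norm] by simp

definition comb :: "('k::finite \<Rightarrow> 'b) \<Rightarrow> real^'k \<Rightarrow> 'b" where
  "comb f m = (\<Oplus>\<^bsub>E\<^esub>i\<in>UNIV. m $ i \<odot>\<^bsub>E\<^esub> f i)"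

context
  fixes f :: "'k::finite \<Rightarrow> 'b"
  assumes f: "\<And>i. f i \<in> carrier E"
begin

lemma comb_closed: "comb f m \<in> carrier E"
  unfolding comb_def using f by (intro M.finsum_closed) auto

lemma comb_add: "comb f (m + m') = comb f m \<oplus>\<^bsub>E\<^esub> comb f m'"
proof -
  have "comb f (m + m') = (\<Oplus>\<^bsub>E\<^esub>i\<in>UNIV. m $ i \<odot>\<^bsub>E\<^esub> f i \<oplus>\<^bsub>E\<^esub> m' $ i \<odot>\<^bsub>E\<^esub> f i)"
    unfolding comb_def using f smult_l_distr by (intro M.finsum_cong') auto
  also have "\<dots> = comb f m \<oplus>\<^bsub>E\<^esub> comb f m'"
    unfolding comb_def using f by (intro M.finsum_addf) auto
  finally show ?thesis .
qed

lemma comb_scale: "comb f (c *\<^sub>R m) = c \<odot>\<^bsub>E\<^esub> comb f m"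
proof -
  have "c \<odot>\<^bsub>E\<^esub> comb f m = (\<Oplus>\<^bsub>E\<^esub>i\<in>UNIV. c \<odot>\<^bsub>E\<^esub> (m $ i \<odot>\<^bsub>E\<^esub> f i))"
    unfolding comb_def using f by (intro finsum_smult_ldistr) auto
  also have "\<dots> = comb f (c *\<^sub>R m)"
    unfolding comb_def using f smult_assoc1 by (intro M.finsum_cong') auto
  finally show ?thesis by simp
qed

lemma comb_axis: "comb f (axis k 1) = f k"
proof -
  have "comb f (axis k 1) = (\<Oplus>\<^bsub>E\<^esub>i\<in>UNIV. if k = i then f i else \<zero>\<^bsub>E\<^esub>)"
    unfolding comb_def using f smult_one smult_l_null by (intro M.finsum_cong') (auto simp: axis_def)
  also have "\<dots> = f k" using f by (intro M.finsum_singleton) auto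
  finally show ?thesis .
qed

lemma comb_diff: "comb f m \<ominus>\<^bsub>E\<^esub> comb f m' = comb f (m - m')"
proof -
  have "comb f m = comb f (m - m') \<oplus>\<^bsub>E\<^esub> comb f m'" using comb_add[of "m - m'" m'] by simp
  then show ?thesis by (simp add: a_minus_def M.a_assoc comb_closed M.r_neg)
qed

lemma seminorm_comb: "seminorm (\<lambda>m. N (comb f m))"
  unfolding seminorm_def by (simp add: comb_add comb_scale N_add N_scale comb_closed)

end

end

lemma Lipschitz_with_Lip:
  assumes "Lipschitz_continuous_map X Z f"
  shows "0 \<le> Lip X Z f" and "Lipschitz_with (Lip X Z f) X Z f"
proof -
  let ?A = "{L. 0 \<le> L \<and> Lipschitz_with L X Z f}"
  obtain B where fX: "f \<in> mspace X \<rightarrow> mspace Z"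
    and B: "\<And>x y. x \<in> mspace X \<Longrightarrow> y \<in> mspace X \<Longrightarrow> mdist Z (f x) (f y) \<le> B * mdist X x y"
    using assms unfolding Lipschitz_continuous_map_def by blast
  have "mdist Z (f x) (f y) \<le> max 0 B * mdist X x y" if "x \<in> mspace X" "y \<in> mspace X" for x y
    using B[OF that] mult_right_mono[of B "max 0 B" "mdist X x y"] by simp
  then have "max 0 B \<in> ?A" using fX by (simp add: Lipschitz_with_def)
  then have ne: "?A \<noteq> {}" by blast
  show nonneg: "0 \<le> Lip X Z f" unfolding Lip_def using ne by (rule cInf_greatest) simp
  show "Lipschitz_with (Lip X Z f) X Z f"
    unfolding Lipschitz_with_def
  proof (intro conjI ballI fX)
    fix x y assume xy: "x \<in> mspace X" "y \<in> mspace X"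
    show "mdist Z (f x) (f y) \<le> Lip X Z f * mdist X x y"
    proof (cases "mdist X x y = 0")
      case True
      then show ?thesis using B[OF xy] by simp
    next
      case False
      then have pos: "0 < mdist X x y" using mdist_nonneg[of X x y] by linarith
      have "mdist Z (f x) (f y) / mdist X x y \<le> Lip X Z f"
        unfolding Lip_def using ne
        by (rule cInf_greatest) (use xy pos in \<open>auto simp: Lipschitz_with_def pos_divide_le_eq\<close>)
      then show ?thesis using pos by (simp add: pos_divide_le_eq)
    qed
  qed
qed

text \<open>
  The two pairs with the largest sum of distances become the diagonals of the rectangle.
\<close>

lemma label_four_points:
  fixes D :: "'a \<Rightarrow> 'a \<Rightarrow> real"
  assumes X: "card X = 4" and sym: "\<And>u v. D u v = D v u"
  obtains x :: "4 \<Rightarrow> 'a" where "bij_betw x UNIV X"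
    and "D (x 1) (x 2) + D (x 3) (x 4) \<le> D (x 1) (x 3) + D (x 2) (x 4)"
    and "D (x 1) (x 4) + D (x 2) (x 3) \<le> D (x 1) (x 3) + D (x 2) (x 4)"
proof -
  have "finite X" using X by (simp add: card_ge_0_finite)
  then obtain e :: "4 \<Rightarrow> 'a" where e: "bij_betw e UNIV X"
    using finite_same_card_bij[of "UNIV :: 4 set" X] X by auto
  have bij: "bij_betw (e \<circ> Transposition.transpose i j) UNIV X" for i j
    using e by (intro bij_betw_trans[of _ _ UNIV]) auto
  let ?s = "D (e 1) (e 3) + D (e 2) (e 4)"
  let ?t = "D (e 1) (e 2) + D (e 3) (e 4)"
  let ?u = "D (e 1) (e 4) + D (e 2) (e 3)"
  consider "?t \<le> ?s" "?u \<le> ?s" | "?s \<le> ?t" "?u \<le> ?t" | "?s \<le> ?u" "?t \<le> ?u" by linarith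
  then show ?thesis
  proof cases
    case 1
    then show ?thesis using that[OF e] by simp
  next
    case 2
    then show ?thesis
      using that[OF bij, of 2 3] sym[of "e 3" "e 2"] by (simp add: Transposition.transpose_def)
  next
    case 3
    then show ?thesis
      using that[OF bij, of 3 4] sym[of "e 4" "e 3"] by (simp add: Transposition.transpose_def)
  qed
qed

lemma extension_from_four_points:
  assumes XY: "metric_subspace X Y" and card: "card (mspace X) = 4"
    and B: "Banach_space E N" and f: "Lipschitz_continuous_map X (norm_metric E N) f"
    and K: "(3 + 6 * sqrt 2) / 7 < K"
  shows "\<exists>g. Lipschitz_with (K * Lip X (norm_metric E N) f) Y (norm_metric E N) g \<and>
    (\<forall>x\<in>mspace X. g x = f x)"
proof -
  interpret normed_module E N using B by (simp add: Banach_space_iff)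
  let ?Z = "norm_metric E N" and ?d = "mdist Y"
  define L where "L = Lip X ?Z f"
  have sub: "mspace X \<subseteq> mspace Y" and dX: "\<And>u v. u \<in> mspace X \<Longrightarrow> v \<in> mspace X \<Longrightarrow> mdist X u v = ?d u v"
    using XY by (auto simp: metric_subspace_def)
  have L: "0 \<le> L" and fX: "\<And>u. u \<in> mspace X \<Longrightarrow> f u \<in> carrier E"
    and fL: "\<And>u v. u \<in> mspace X \<Longrightarrow> v \<in> mspace X \<Longrightarrow> N (f u \<ominus>\<^bsub>E\<^esub> f v) \<le> L * ?d u v"
    using Lipschitz_with_Lip[OF f] mdist_norm_metric dX
    by (auto simp: L_def Lipschitz_with_def Pi_iff)
  obtain x :: "4 \<Rightarrow> 'a" where x: "bij_betw x UNIV (mspace X)"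
    and m1: "?d (x 1) (x 2) + ?d (x 3) (x 4) \<le> ?d (x 1) (x 3) + ?d (x 2) (x 4)"
    and m2: "?d (x 1) (x 4) + ?d (x 2) (x 3) \<le> ?d (x 1) (x 3) + ?d (x 2) (x 4)"
    using label_four_points[OF card, of ?d] mdist_commute by metis
  have xX: "x i \<in> mspace X" for i using x by (auto simp: bij_betw_def)
  have xY: "x i \<in> mspace Y" for i using xX sub by auto
  show ?thesis
  proof (cases "L = 0")
    case True
    \<comment> \<open>dividing the norm by \<open>L\<close>, as below, would be meaningless\<close>
    have "f u = f (x 1)" if "u \<in> mspace X" for u
      using fL[OF that xX[of 1]] True N_nonneg[of "f u \<ominus>\<^bsub>E\<^esub> f (x 1)"] N_eq_0[of "f u \<ominus>\<^bsub>E\<^esub> f (x 1)"]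
        fX[OF that] fX[OF xX[of 1]] by (simp add: minus_eq_0_iff)
    moreover have "mdist ?Z (f (x 1)) (f (x 1)) \<le> 0" by (rule eq_refl) (simp add: fX xX)
    then have "Lipschitz_with (K * L) Y ?Z (\<lambda>_. f (x 1))"
      using True fX[OF xX[of 1]] by (simp add: Lipschitz_with_def)
    ultimately show ?thesis unfolding L_def by (intro exI[of _ "\<lambda>_. f (x 1)"]) simp
  next
    case False
    then have Lpos: "0 < L" using L by simp
    let ?D = "\<lambda>i j. ?d (x i) (x j)"
    let ?C = "comb (\<lambda>i. f (x i))"
    define p where "p m = N (?C m) / L" for m
    have carr: "f (x i) \<in> carrier E" for i using fX xX by blast
    have D: "pseudometric ?D"
      unfolding pseudometric_def using mdist_triangle[of _ Y] xY mdist_commute[of Y] by simp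
    have ne: "?D i j \<noteq> 0" if "i \<noteq> j" for i j
      using x that xY by (auto simp: bij_betw_def inj_on_def)
    have p: "seminorm p"
    proof -
      have "seminorm (\<lambda>m. N (?C m))" by (rule seminorm_comb) (rule carr)
      then show ?thesis using Lpos
        by (auto simp: seminorm_def p_def add_divide_distrib[symmetric] divide_right_mono)
    qed
    have pD: "p (axis i 1 - axis j 1) \<le> ?D i j" for i j
    proof -
      have "?C (axis i 1 - axis j 1) = f (x i) \<ominus>\<^bsub>E\<^esub> f (x j)"
        using comb_diff[of "\<lambda>i. f (x i)" "axis i 1" "axis j 1"] comb_axis[of "\<lambda>i. f (x i)"] carr by simp
      then show ?thesis using fL[OF xX xX, of i j] Lpos by (simp add: p_def pos_divide_le_eq mult.commute)
    qed
    obtain pos \<gamma> where iso: "\<And>i j. l1_dist (pos i) (pos j) = ?D i j" and \<gamma>x: "\<And>i. \<gamma> (pos i) = axis i 1"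
      and \<gamma>: "\<And>z z'. p (\<gamma> z - \<gamma> z') \<le> K * l1_dist z z'"
      using four_point_extension[OF D ne m1 m2 p pD K] by metis
    \<comment> \<open>the sum and the difference of the coordinates of the four points extend to \<open>Y\<close>, and define a
      nonexpansive map \<open>r\<close> from \<open>Y\<close> to the plane\<close>
    define ix where "ix = inv_into UNIV x"
    have ix: "ix (x i) = i" for i using x by (simp add: ix_def bij_betw_def)
    have xix: "x (ix u) = u" if "u \<in> mspace X" for u
      using x that by (auto simp: ix_def bij_betw_def f_inv_into_f)
    have Xne: "mspace X \<noteq> {}" and finX: "finite (mspace X)" using card by (auto intro: card_ge_0_finite)
    have coord: "\<exists>h. (\<forall>u\<in>mspace X. h u = c (pos (ix u))) \<and> (\<forall>u\<in>mspace Y. \<forall>v\<in>mspace Y. \<bar>h u - h v\<bar> \<le> ?d u v)"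
      if c: "\<And>z z'. c z - c z' \<le> l1_dist z z'" for c :: "real \<times> real \<Rightarrow> real"
    proof -
      obtain h where "\<And>u. u \<in> mspace X \<Longrightarrow> h u = c (pos (ix u))"
        "\<And>u v. u \<in> mspace Y \<Longrightarrow> v \<in> mspace Y \<Longrightarrow> \<bar>h u - h v\<bar> \<le> ?d u v"
      proof (rule mcshane_extension[of ?d "mspace Y" "mspace X" "\<lambda>u. c (pos (ix u))"])
        show "c (pos (ix u)) - c (pos (ix v)) \<le> ?d u v" if "u \<in> mspace X" "v \<in> mspace X" for u v
          using c[of "pos (ix u)" "pos (ix v)"] that by (simp add: iso xix)
      qed (use Xne finX sub in \<open>auto simp: mdist_commute mdist_triangle\<close>)
      then show ?thesis by blast
    qed
    obtain h1 where h1: "\<And>u. u \<in> mspace X \<Longrightarrow> h1 u = fst (pos (ix u)) + snd (pos (ix u))"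
      and h1_lip: "\<And>u v. u \<in> mspace Y \<Longrightarrow> v \<in> mspace Y \<Longrightarrow> \<bar>h1 u - h1 v\<bar> \<le> ?d u v"
      using coord[of "\<lambda>z. fst z + snd z"] unfolding l1_dist_def by (smt (verit))
    obtain h2 where h2: "\<And>u. u \<in> mspace X \<Longrightarrow> h2 u = fst (pos (ix u)) - snd (pos (ix u))"
      and h2_lip: "\<And>u v. u \<in> mspace Y \<Longrightarrow> v \<in> mspace Y \<Longrightarrow> \<bar>h2 u - h2 v\<bar> \<le> ?d u v"
      using coord[of "\<lambda>z. fst z - snd z"] unfolding l1_dist_def by (smt (verit))
    define r where "r u = ((h1 u + h2 u) / 2, (h1 u - h2 u) / 2)" for u
    have r_lip: "l1_dist (r u) (r v) \<le> ?d u v" if "u \<in> mspace Y" "v \<in> mspace Y" for u v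
    proof -
      have "l1_dist (r u) (r v) = (\<bar>(h1 u - h1 v) + (h2 u - h2 v)\<bar> + \<bar>(h1 u - h1 v) - (h2 u - h2 v)\<bar>) / 2"
        unfolding r_def l1_dist_def by (simp add: diff_divide_distrib[symmetric] algebra_simps)
      moreover have "(\<bar>A + B\<bar> + \<bar>A - B\<bar>) / 2 \<le> m" if "\<bar>A\<bar> \<le> m" "\<bar>B\<bar> \<le> m" for A B m :: real
        using that by (auto simp: abs_if split: if_splits)
      ultimately show ?thesis using h1_lip[OF that] h2_lip[OF that] by simp
    qed
    have rx: "r u = pos (ix u)" if "u \<in> mspace X" for u
      using h1[OF that] h2[OF that] by (simp add: r_def prod_eq_iff)
    define g where "g u = ?C (\<gamma> (r u))" for u
    have gE: "g u \<in> carrier E" for u unfolding g_def by (rule comb_closed) (rule carr)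
    have "g u = f u" if "u \<in> mspace X" for u
      using that comb_axis[of "\<lambda>i. f (x i)", OF carr] by (simp add: g_def rx \<gamma>x xix)
    moreover have "Lipschitz_with (K * L) Y ?Z g"
      unfolding Lipschitz_with_def
    proof (intro conjI ballI)
      show "g \<in> mspace Y \<rightarrow> mspace ?Z" using gE by simp
      fix u v assume uv: "u \<in> mspace Y" "v \<in> mspace Y"
      have "mdist ?Z (g u) (g v) = N (?C (\<gamma> (r u) - \<gamma> (r v)))"
        using gE mdist_norm_metric comb_diff[of "\<lambda>i. f (x i)", OF carr] by (simp add: g_def)
      also have "\<dots> = L * p (\<gamma> (r u) - \<gamma> (r v))" using Lpos by (simp add: p_def)
      also have "\<dots> \<le> L * (K * l1_dist (r u) (r v))" using Lpos by (intro mult_left_mono \<gamma>) auto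
      also have "\<dots> \<le> L * (K * ?d u v)"
      proof -
        have "0 \<le> K" using K by (smt (verit) divide_nonneg_nonneg real_sqrt_ge_zero)
        then show ?thesis using Lpos r_lip[OF uv] by (intro mult_left_mono) auto
      qed
      finally show "mdist ?Z (g u) (g v) \<le> K * L * ?d u v" by (simp add: mult_ac)
    qed
    ultimately show ?thesis unfolding L_def by blast
  qed
qed

lemma ae_4_le: "ae TYPE('a) TYPE('b) 4 \<le> ereal ((3 + 6 * sqrt 2) / 7)"
proof -
  have "ext_const X Y (norm_metric E N) f \<le> ereal ((3 + 6 * sqrt 2) / 7)"
    if "card (mspace X) = 4" "metric_subspace X Y" "Banach_space E N"
      "Lipschitz_continuous_map X (norm_metric E N) f"
    for X Y :: "'a metric" and E :: "(real, 'b) module" and N f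
  proof (rule ereal_le_epsilon2)
    fix \<epsilon> :: real assume "0 < \<epsilon>"
    then have K: "(3 + 6 * sqrt 2) / 7 < (3 + 6 * sqrt 2) / 7 + \<epsilon>" by simp
    have "0 \<le> (3 + 6 * sqrt 2) / 7 + \<epsilon>" using \<open>0 < \<epsilon>\<close> by simp
    with extension_from_four_points[OF that(2,1,3,4) K]
    have "ext_const X Y (norm_metric E N) f \<le> ereal ((3 + 6 * sqrt 2) / 7 + \<epsilon>)"
      unfolding ext_const_def by (intro Inf_lower) blast
    then show "ext_const X Y (norm_metric E N) f \<le> ereal ((3 + 6 * sqrt 2) / 7) + ereal \<epsilon>" by simp
  qed
  then show ?thesis
    unfolding ae_def ae_space_def nu_def by (intro Sup_least) (auto intro!: Sup_least)
qed

section \<open>Copies of the plane and of three-space\<close>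

lemma Times_lepoll_infinite: "infinite A \<Longrightarrow> A \<times> A \<lesssim> A"
  using card_of_Times_same_infinite[of A] eqpoll_iff_card_of_ordIso eqpoll_imp_lepoll by blast

lemma real_square_lepoll: "(UNIV :: (real \<times> real) set) \<lesssim> (UNIV :: real set)"
  using Times_lepoll_infinite[OF infinite_UNIV_char_0[where 'a = real]] by simp

lemma real_cube_lepoll: "(UNIV :: (real \<times> real \<times> real) set) \<lesssim> (UNIV :: real set)"
proof -
  have "(UNIV :: real set) \<times> (UNIV :: (real \<times> real) set) \<lesssim> (UNIV :: real set) \<times> (UNIV :: real set)"
    by (intro times_lepoll_mono lepoll_refl real_square_lepoll)
  also have "\<dots> \<lesssim> (UNIV :: real set)" by (intro Times_lepoll_infinite infinite_UNIV_char_0)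
  finally show ?thesis by simp
qed

text \<open>
  \<open>mult\<close> and \<open>one\<close> are fields inherited from the ring record and get default values.
\<close>

definition transported_module :: "('v::real_vector \<Rightarrow> 'b) \<Rightarrow> (real, 'b) module" where
  "transported_module j = \<lparr>carrier = range j, mult = (\<lambda>u v. u), one = j 0, zero = j 0,
     add = (\<lambda>u v. j (inv_into UNIV j u + inv_into UNIV j v)), smult = (\<lambda>c u. j (c *\<^sub>R inv_into UNIV j u))\<rparr>"

lemma cring_real_field_ring: "cring real_field_ring"
proof (rule cringI)
  show "abelian_group real_field_ring"
  proof (rule abelian_groupI)
    show "\<exists>y\<in>carrier real_field_ring. y \<oplus>\<^bsub>real_field_ring\<^esub> x = \<zero>\<^bsub>real_field_ring\<^esub>" for x
      by (rule bexI[of _ "- x"]) simp_all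
  qed simp_all
  show "comm_monoid real_field_ring" by unfold_locales (simp_all add: mult_ac)
qed (simp_all add: distrib_right)

lemma normed_module_transported:
  fixes j :: "'v::real_vector \<Rightarrow> 'b"
  assumes j: "inj j" and N: "seminorm N" and def: "\<And>v. N v = 0 \<Longrightarrow> v = 0"
  shows "normed_module (transported_module j) (\<lambda>u. N (inv_into UNIV j u))"
proof -
  let ?E = "transported_module j"
  have simps [simp]: "carrier ?E = range j" "zero ?E = j 0" "add ?E (j u) (j v) = j (u + v)"
    "smult ?E c (j u) = j (c *\<^sub>R u)" for u v c
    using j by (simp_all add: transported_module_def)
  have "abelian_group ?E"
  proof (rule abelian_groupI)
    show "\<exists>y\<in>carrier ?E. y \<oplus>\<^bsub>?E\<^esub> x = \<zero>\<^bsub>?E\<^esub>" if x: "x \<in> carrier ?E" for x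
    proof -
      obtain v where "x = j v" using x by auto
      then show ?thesis by (intro bexI[of _ "j (- v)"]) simp_all
    qed
  qed (auto simp: ac_simps)
  then have "Module.module real_field_ring ?E"
    by (intro moduleI cring_real_field_ring) (auto simp: algebra_simps)
  then show ?thesis
    unfolding normed_module_def normed_module_axioms_def
    using j seminorm_nonneg[OF N] seminorm_scale[OF N] seminorm_add[OF N] seminorm_zero[OF N] def
    by (auto simp: inj_eq)
qed

lemma mdist_transported:
  fixes j :: "'v::real_vector \<Rightarrow> 'b"
  assumes j: "inj j" and N: "seminorm N" and def: "\<And>v. N v = 0 \<Longrightarrow> v = 0"
  shows "mdist (norm_metric (transported_module j) (\<lambda>u. N (inv_into UNIV j u))) (j u) (j v) = N (u - v)"
proof -
  let ?E = "transported_module j"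
  interpret normed_module ?E "\<lambda>u. N (inv_into UNIV j u)" by (rule normed_module_transported[OF assms])
  have simps [simp]: "carrier ?E = range j" "zero ?E = j 0" "add ?E (j u) (j v) = j (u + v)" for u v
    using j by (simp_all add: transported_module_def)
  have "\<ominus>\<^bsub>?E\<^esub> (j v) = j (- v)" by (rule M.minus_equality) simp_all
  then have "j u \<ominus>\<^bsub>?E\<^esub> j v = j (u - v)" by (simp add: a_minus_def)
  then show ?thesis using j by (simp add: mdist_norm_metric)
qed

text \<open>
  By the equivalence of the norms, completeness is inherited from \<open>'v\<close>.
\<close>

lemma Banach_space_transported:
  fixes j :: "'v::banach \<Rightarrow> 'b"
  assumes j: "inj j" and N: "seminorm N" and lower: "\<And>v. norm v \<le> C * N v" and upper: "\<And>v. N v \<le> D * norm v"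
  shows "Banach_space (transported_module j) (\<lambda>u. N (inv_into UNIV j u))"
proof -
  let ?E = "transported_module j" and ?N = "\<lambda>u. N (inv_into UNIV j u)"
  have def: "v = 0" if "N v = 0" for v using lower[of v] that by simp
  interpret normed_module ?E ?N by (rule normed_module_transported[OF j N def])
  let ?d = "mdist (norm_metric ?E ?N)"
  have d: "?d (j u) (j v) = N (u - v)" for u v by (rule mdist_transported[OF j N def])
  have carr: "carrier ?E = range j" by (simp add: transported_module_def)
  interpret Z: Metric_space "range j" ?d
    using Metric_space_mspace_mdist[of "norm_metric ?E ?N"] by (simp add: carr)
  have "Z.mcomplete"
    unfolding Z.mcomplete_def
  proof (intro allI impI)
    fix \<sigma> assume \<sigma>: "Z.MCauchy \<sigma>"
    define s where "s n = inv_into UNIV j (\<sigma> n)" for n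
    have "\<sigma> n \<in> range j" for n using \<sigma> by (auto simp: Z.MCauchy_def)
    then have \<sigma>s: "\<sigma> n = j (s n)" for n by (simp add: s_def f_inv_into_f)
    define C' where "C' = max C 1"
    have C': "norm v \<le> C' * N v" for v
      using lower[of v] mult_right_mono[of C C' "N v"] seminorm_nonneg[OF N, of v] by (simp add: C'_def)
    have "Cauchy s"
    proof (rule metric_CauchyI)
      fix e :: real assume "0 < e"
      then have "0 < e / C'" by (simp add: C'_def)
      then obtain n0 where n0: "\<And>n n'. n0 \<le> n \<Longrightarrow> n0 \<le> n' \<Longrightarrow> ?d (\<sigma> n) (\<sigma> n') < e / C'"
        using \<sigma> unfolding Z.MCauchy_def by blast
      have "dist (s m) (s n) < e" if "n0 \<le> m" "n0 \<le> n" for m n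
      proof -
        have "dist (s m) (s n) \<le> C' * N (s m - s n)" using C' by (simp add: dist_norm)
        also have "\<dots> < C' * (e / C')"
          using n0[OF that] by (intro mult_strict_left_mono) (auto simp: \<sigma>s d C'_def)
        finally show ?thesis by (simp add: C'_def)
      qed
      then show "\<exists>M. \<forall>m\<ge>M. \<forall>n\<ge>M. dist (s m) (s n) < e" by blast
    qed
    then obtain v where v: "s \<longlonglongrightarrow> v" using Cauchy_convergent convergent_def by blast
    have "(\<lambda>n. norm (s n - v)) \<longlonglongrightarrow> 0" using v by (intro tendsto_norm_zero LIM_zero)
    then have lim: "(\<lambda>n. D * norm (s n - v)) \<longlonglongrightarrow> 0" by (rule tendsto_mult_right_zero)
    have "(\<lambda>n. N (s n - v)) \<longlonglongrightarrow> 0"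
      by (rule tendsto_sandwich[OF _ _ tendsto_const lim]) (simp_all add: seminorm_nonneg[OF N] upper)
    then show "\<exists>x. limitin Z.mtopology \<sigma> x sequentially"
      by (intro exI[of _ "j v"]) (simp add: Z.limitin_metric_dist_null \<sigma>s d)
  qed
  then have "mcomplete_of (norm_metric ?E ?N)" by (simp add: mcomplete_of_def carr)
  then show ?thesis using normed_module_axioms by (simp add: Banach_space_iff)
qed

definition plane_copy :: "(real \<times> real \<Rightarrow> 'a) \<Rightarrow> (real \<times> real) set \<Rightarrow> 'a metric" where
  "plane_copy j A = metric (j ` A, \<lambda>u v. l1_dist (inv_into UNIV j u) (inv_into UNIV j v))"

lemma Metric_space_plane_copy:
  assumes "inj j"
  shows "Metric_space (j ` A) (\<lambda>u v. l1_dist (inv_into UNIV j u) (inv_into UNIV j v))"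
  using assms by unfold_locales
    (auto simp: l1_dist_nonneg l1_dist_commute l1_dist_eq_0 l1_dist_triangle inj_eq)

lemma plane_copy:
  assumes "inj j"
  shows "mspace (plane_copy j A) = j ` A" and "mdist (plane_copy j A) (j z) (j z') = l1_dist z z'"
  using Metric_space.mspace_metric[OF Metric_space_plane_copy[OF assms]]
    Metric_space.mdist_metric[OF Metric_space_plane_copy[OF assms]] assms
  by (auto simp: plane_copy_def)

section \<open>The lower bound\<close>

text \<open>
  The leaves of the tree with inner vertices \<open>(0, 0)\<close> and \<open>(sqrt 2 - 1, 0)\<close>, all of whose leaf edges have
  length 1. They are placed so that the \<open>l1\<close> distance is the path distance in the tree.
\<close>

definition tree_leaves :: "(real \<times> real) set" where
  "tree_leaves = {(-1, 0), (0, 1), (sqrt 2, 0), (sqrt 2 - 1, -1)}"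

text \<open>
  The coordinates of the image of a leaf are its values under three functions on the leaves: one
  separates the first two leaves, one the last two, and the third is constant on each of these two pairs.
\<close>

definition leaf_image :: "real \<times> real \<Rightarrow> real \<times> real \<times> real" where
  "leaf_image z = (if z = (-1, 0) then (1, 0, sqrt 2 / 2) else if z = (0, 1) then (-1, 0, sqrt 2 / 2)
     else if z = (sqrt 2, 0) then (0, 1, - (sqrt 2 / 2)) else (0, -1, - (sqrt 2 / 2)))"

text \<open>
  The smallest norm for which five functionals have norm at most 1: \<open>\<plusminus>x + z\<close> and \<open>\<plusminus>y - z\<close>, one
  for each leaf, and \<open>(1 + sqrt 2 / 2) * z\<close> for the inner edge.
\<close>

definition leaf_norm :: "real \<times> real \<times> real \<Rightarrow> real" where
  "leaf_norm v = (case v of (x, y, z) \<Rightarrow> max (max \<bar>x\<bar> \<bar>y\<bar> + \<bar>z\<bar>) ((1 + sqrt 2 / 2) * \<bar>z\<bar>))"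

lemma sqrt_2_cases:
  obtains s where "sqrt 2 = s" "1 < s" "s < 2" "s * s = (2::real)"
proof -
  have "sqrt 2 < (2::real)" using real_sqrt_less_mono[of 2 4] unfolding real_sqrt_four by simp
  then show ?thesis using that[of "sqrt 2"] by simp
qed

lemma leaf_norm_le_iff:
  "leaf_norm (x, y, z) \<le> M \<longleftrightarrow> \<bar>x\<bar> + \<bar>z\<bar> \<le> M \<and> \<bar>y\<bar> + \<bar>z\<bar> \<le> M \<and> (1 + sqrt 2 / 2) * \<bar>z\<bar> \<le> M"
  by (auto simp: leaf_norm_def max_def)

lemma seminorm_leaf_norm: "seminorm leaf_norm"
  unfolding seminorm_def
proof (intro conjI allI)
  fix u v :: "real \<times> real \<times> real" and c :: real
  obtain x y z where u: "u = (x, y, z)" by (cases u)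
  obtain x' y' z' where v: "v = (x', y', z')" by (cases v)
  note U = leaf_norm_le_iff[of x y z "leaf_norm u", folded u, THEN iffD1, OF order_refl]
  note V = leaf_norm_le_iff[of x' y' z' "leaf_norm v", folded v, THEN iffD1, OF order_refl]
  have "(1 + sqrt 2 / 2) * \<bar>z + z'\<bar> \<le> (1 + sqrt 2 / 2) * (\<bar>z\<bar> + \<bar>z'\<bar>)"
    by (intro mult_left_mono abs_triangle_ineq) simp
  then have "(1 + sqrt 2 / 2) * \<bar>z + z'\<bar> \<le> (1 + sqrt 2 / 2) * \<bar>z\<bar> + (1 + sqrt 2 / 2) * \<bar>z'\<bar>"
    by (simp only: distrib_left)
  then have "(1 + sqrt 2 / 2) * \<bar>z + z'\<bar> \<le> leaf_norm u + leaf_norm v"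
    by (rule order_trans) (intro add_mono conjunct2[OF conjunct2[OF U]] conjunct2[OF conjunct2[OF V]])
  moreover have add: "\<bar>r + r'\<bar> + \<bar>z + z'\<bar> \<le> leaf_norm u + leaf_norm v"
    if "\<bar>r\<bar> + \<bar>z\<bar> \<le> leaf_norm u" "\<bar>r'\<bar> + \<bar>z'\<bar> \<le> leaf_norm v" for r r'
  proof -
    have "\<bar>r + r'\<bar> + \<bar>z + z'\<bar> \<le> (\<bar>r\<bar> + \<bar>r'\<bar>) + (\<bar>z\<bar> + \<bar>z'\<bar>)" by (intro add_mono abs_triangle_ineq)
    also have "\<dots> = (\<bar>r\<bar> + \<bar>z\<bar>) + (\<bar>r'\<bar> + \<bar>z'\<bar>)" by (simp only: ac_simps)
    also have "\<dots> \<le> leaf_norm u + leaf_norm v" by (intro add_mono that)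
    finally show ?thesis .
  qed
  ultimately have "leaf_norm (x + x', y + y', z + z') \<le> leaf_norm u + leaf_norm v"
    unfolding leaf_norm_le_iff using U V by (intro conjI add) blast+
  then show "leaf_norm (u + v) \<le> leaf_norm u + leaf_norm v" by (simp add: u v)
  have "max (max (k * r) (k * s) + k * t) (q * (k * t)) = k * max (max r s + t) (q * t)"
    if "0 \<le> k" for k q r s t :: real
  proof -
    have "q * (k * t) = k * (q * t)" by simp
    then show ?thesis
      using that by (simp only: max_mult_distrib_left distrib_left if_True)
  qed
  from this[OF abs_ge_zero[of c]] show "leaf_norm (c *\<^sub>R u) = \<bar>c\<bar> * leaf_norm u"
    unfolding u leaf_norm_def by (simp only: scaleR_Pair real_scaleR_def abs_mult prod.case)
qed

lemma leaf_norm_equiv: "norm v \<le> 3 * leaf_norm v" "leaf_norm v \<le> 4 * norm v"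
proof -
  obtain x y z where v: "v = (x, y, z)" by (cases v)
  note U = leaf_norm_le_iff[of x y z "leaf_norm v", folded v, THEN iffD1, OF order_refl]
  have "norm v \<le> \<bar>x\<bar> + (\<bar>y\<bar> + \<bar>z\<bar>)"
    unfolding v using norm_Pair_le[of x "(y, z)"] norm_Pair_le[of y z] by simp
  then show "norm v \<le> 3 * leaf_norm v" using U by linarith
  have x: "\<bar>x\<bar> \<le> norm v" and yz: "norm (y, z) \<le> norm v"
    unfolding v using norm_fst_le[of x "(y, z)"] norm_snd_le[of "(y, z)" x] by simp_all
  have y: "\<bar>y\<bar> \<le> norm v" and z: "\<bar>z\<bar> \<le> norm v"
    using yz norm_fst_le[of y z] norm_snd_le[of z y] by simp_all
  have "sqrt 2 \<le> 2" by (rule sqrt_2_cases) simp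
  then have "(1 + sqrt 2 / 2) * \<bar>z\<bar> \<le> 2 * norm v" using z by (intro mult_mono) auto
  then have "leaf_norm (x, y, z) \<le> 4 * norm v"
    unfolding leaf_norm_le_iff
    using add_mono[OF x z] add_mono[OF y z] norm_ge_zero[of v] by (intro conjI) linarith+
  then show "leaf_norm v \<le> 4 * norm v" by (simp add: v)
qed

lemma leaf_image_simps:
  "leaf_image (-1, 0) = (1, 0, sqrt 2 / 2)" "leaf_image (0, 1) = (-1, 0, sqrt 2 / 2)"
  "leaf_image (sqrt 2, 0) = (0, 1, - (sqrt 2 / 2))" "leaf_image (sqrt 2 - 1, -1) = (0, -1, - (sqrt 2 / 2))"
  by (rule sqrt_2_cases; simp add: leaf_image_def)+

lemma leaf_image_nonexpansive:
  assumes "z \<in> tree_leaves" "z' \<in> tree_leaves"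
  shows "leaf_norm (leaf_image z - leaf_image z') \<le> l1_dist z z'"
proof -
  let ?P = "\<lambda>z z'. leaf_norm (leaf_image z - leaf_image z') \<le> l1_dist z z'"
  have comm: "?P z' z" if "?P z z'" for z z'
    using that by (simp only: seminorm_minus_commute[OF seminorm_leaf_norm, of "leaf_image z'"] l1_dist_commute[of z'])
  have refl: "?P z z" for z by (simp add: seminorm_zero[OF seminorm_leaf_norm] l1_dist_nonneg)
  obtain s where s: "sqrt 2 = s" and s_bounds: "1 < s" "s < 2" and ss: "s * s = 2" by (rule sqrt_2_cases)
  have third: "(1 + s / 2) * \<bar>s / 2 - - (s / 2)\<bar> = 1 + s"
    using s_bounds ss by (simp add: algebra_simps)
  have pairs: "?P (-1, 0) (0, 1)" "?P (-1, 0) (sqrt 2, 0)" "?P (-1, 0) (sqrt 2 - 1, -1)"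
    "?P (0, 1) (sqrt 2, 0)" "?P (0, 1) (sqrt 2 - 1, -1)" "?P (sqrt 2, 0) (sqrt 2 - 1, -1)"
    unfolding leaf_image_simps diff_Pair leaf_norm_le_iff l1_dist_def fst_conv snd_conv
    unfolding s third
    using s_bounds by simp_all
  from assms show ?thesis
    unfolding tree_leaves_def by (elim insertE emptyE; simp only: pairs refl pairs[THEN comm])
qed

text \<open>
  \<open>v\<close> and \<open>v'\<close> are the images of the inner vertices. The functionals \<open>x + z\<close> and \<open>z - x\<close> at the leaves
  next to \<open>v\<close>, and \<open>y - z\<close> and \<open>- y - z\<close> at those next to \<open>v'\<close>, add up to an estimate that depends only on
  the difference of the third coordinates of \<open>v\<close> and \<open>v'\<close>, which the inner edge bounds.
  The length \<open>sqrt 2 - 1\<close> of the inner edge maximizes the resulting bound.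
\<close>

lemma leaf_image_extension_bound:
  assumes K: "leaf_norm (leaf_image (-1, 0) - v) \<le> K" "leaf_norm (leaf_image (0, 1) - v) \<le> K"
    "leaf_norm (leaf_image (sqrt 2, 0) - v') \<le> K" "leaf_norm (leaf_image (sqrt 2 - 1, -1) - v') \<le> K"
    and mid: "leaf_norm (v - v') \<le> K * (sqrt 2 - 1)"
  shows "(5 + 4 * sqrt 2) / 7 \<le> K"
proof -
  obtain x y z where v: "v = (x, y, z)" by (cases v)
  obtain x' y' z' where v': "v' = (x', y', z')" by (cases v')
  let ?s = "sqrt 2"
  have ss: "?s * ?s = 2" by simp
  have sqrt_le: "?s \<le> 2" by (rule sqrt_2_cases) simp
  have "\<bar>1 - x\<bar> + \<bar>?s / 2 - z\<bar> \<le> K" "\<bar>-1 - x\<bar> + \<bar>?s / 2 - z\<bar> \<le> K"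
    "\<bar>1 - y'\<bar> + \<bar>- (?s / 2) - z'\<bar> \<le> K" "\<bar>-1 - y'\<bar> + \<bar>- (?s / 2) - z'\<bar> \<le> K"
    using K unfolding v v' leaf_image_simps diff_Pair leaf_norm_le_iff by blast+
  moreover have "r + t \<le> M \<and> t - r \<le> M \<and> r - t \<le> M \<and> - r - t \<le> M" if "\<bar>r\<bar> + \<bar>t\<bar> \<le> M" for r t M :: real
    using that by linarith
  ultimately have "(1 - x) + (?s / 2 - z) \<le> K" "(?s / 2 - z) - (-1 - x) \<le> K"
    "(1 - y') - (- (?s / 2) - z') \<le> K" "- (-1 - y') - (- (?s / 2) - z') \<le> K" by blast+
  then have 1: "4 + 2 * ?s - 2 * (z - z') \<le> 4 * K" by (simp add: field_simps)
  have "(1 + ?s / 2) * (z - z') \<le> (1 + ?s / 2) * \<bar>z - z'\<bar>" by (intro mult_left_mono) auto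
  also have "\<dots> \<le> K * (?s - 1)" using mid unfolding v v' diff_Pair leaf_norm_le_iff by blast
  \<comment> \<open>\<open>2 - sqrt 2\<close> is the reciprocal of \<open>1 + sqrt 2 / 2\<close>\<close>
  finally have "(2 - ?s) * ((1 + ?s / 2) * (z - z')) \<le> (2 - ?s) * (K * (?s - 1))"
    using sqrt_le by (intro mult_left_mono) auto
  moreover have "(2 - ?s) * ((1 + ?s / 2) * (z - z')) = (2 - (?s * ?s) / 2) * (z - z')"
    by (simp add: field_simps)
  moreover have "(2 - ?s) * (K * (?s - 1)) = K * (3 * ?s - 2 - ?s * ?s)" by (simp add: algebra_simps)
  ultimately have "z - z' \<le> K * (3 * ?s - 4)" unfolding ss by simp
  with 1 have "2 + ?s \<le> K * (3 * ?s - 2)" by (simp add: algebra_simps)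
  then have "(3 * ?s + 2) * (2 + ?s) \<le> (3 * ?s + 2) * (K * (3 * ?s - 2))" by (intro mult_left_mono) auto
  moreover have "(3 * ?s + 2) * (2 + ?s) = 3 * (?s * ?s) + 8 * ?s + 4" by (simp add: algebra_simps)
  moreover have "(3 * ?s + 2) * (K * (3 * ?s - 2)) = K * (9 * (?s * ?s) - 4)" by (simp add: algebra_simps)
  ultimately show ?thesis unfolding ss by simp
qed

lemma le_ae_4:
  assumes "(UNIV :: real set) \<lesssim> (UNIV :: 'a set)" and "(UNIV :: real set) \<lesssim> (UNIV :: 'b set)"
  shows "ereal ((5 + 4 * sqrt 2) / 7) \<le> ae TYPE('a) TYPE('b) 4"
proof -
  obtain j :: "real \<times> real \<Rightarrow> 'a" where j: "inj j"
    using lepoll_trans[OF real_square_lepoll assms(1)] unfolding lepoll_def by (elim exE conjE)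
  obtain k :: "real \<times> real \<times> real \<Rightarrow> 'b" where k: "inj k"
    using lepoll_trans[OF real_cube_lepoll assms(2)] unfolding lepoll_def by (elim exE conjE)
  define X where "X = plane_copy j tree_leaves"
  define Y where "Y = plane_copy j UNIV"
  define E where "E = transported_module k"
  define N where "N u = leaf_norm (inv_into UNIV k u)" for u
  let ?Z = "norm_metric E N"
  define f where "f u = k (leaf_image (inv_into UNIV j u))" for u
  have spaces: "mspace X = j ` tree_leaves" "mspace Y = range j"
    and dX: "\<And>z z'. mdist X (j z) (j z') = l1_dist z z'" and dY: "\<And>z z'. mdist Y (j z) (j z') = l1_dist z z'"
    using plane_copy[OF j] by (auto simp: X_def Y_def)
  have sub: "metric_subspace X Y" by (auto simp: metric_subspace_def spaces dX dY)
  have "card tree_leaves = 4" by (rule sqrt_2_cases) (simp add: tree_leaves_def)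
  then have cardX: "finite (mspace X)" "card (mspace X) = 4"
    using card_image[OF inj_on_subset[OF j subset_UNIV], of tree_leaves]
    by (simp_all add: spaces) (simp add: tree_leaves_def)
  have B: "Banach_space E N"
    unfolding E_def N_def by (rule Banach_space_transported[OF k seminorm_leaf_norm leaf_norm_equiv])
  have def: "v = 0" if "leaf_norm v = 0" for v using leaf_norm_equiv(1)[of v] that by simp
  have dZ: "mdist ?Z (k u) (k v) = leaf_norm (u - v)" for u v
    unfolding E_def N_def by (rule mdist_transported[OF k seminorm_leaf_norm def])
  interpret normed_module E N using B by (simp add: Banach_space_iff)
  have Z: "carrier E = range k" by (simp add: E_def transported_module_def)
  have f1: "Lipschitz_with 1 X ?Z f"
    using j by (auto simp: Lipschitz_with_def spaces Z dX f_def dZ leaf_image_nonexpansive)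
  then have f: "Lipschitz_continuous_map X ?Z f"
    unfolding Lipschitz_with_def Lipschitz_continuous_map_def by blast
  have Lip: "Lip X ?Z f \<le> 1"
    unfolding Lip_def using f1 by (intro cInf_lower) (auto intro: bdd_belowI[of _ 0])
  have "ereal ((5 + 4 * sqrt 2) / 7) \<le> ext_const X Y ?Z f"
    unfolding ext_const_def
  proof (rule Inf_greatest)
    fix e assume "e \<in> {ereal K |K. 0 \<le> K \<and> (\<exists>g. Lipschitz_with (K * Lip X ?Z f) Y ?Z g \<and> (\<forall>x\<in>mspace X. g x = f x))}"
    then obtain K g where e: "e = ereal K" and K: "0 \<le> K"
      and g: "Lipschitz_with (K * Lip X ?Z f) Y ?Z g" and gf: "\<And>x. x \<in> mspace X \<Longrightarrow> g x = f x" by blast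
    define h where "h z = inv_into UNIV k (g (j z))" for z
    have "g (j z) \<in> range k" for z using g by (auto simp: Lipschitz_with_def spaces Z)
    then have gh: "g (j z) = k (h z)" for z by (simp add: h_def f_inv_into_f)
    have h_lip: "leaf_norm (h z - h z') \<le> K * l1_dist z z'" for z z'
    proof -
      have "leaf_norm (h z - h z') \<le> K * Lip X ?Z f * l1_dist z z'"
        using g unfolding Lipschitz_with_def spaces by (metis dY dZ gh rangeI)
      also have "\<dots> \<le> K * 1 * l1_dist z z'" using Lip K by (intro mult_right_mono mult_left_mono l1_dist_nonneg)
      finally show ?thesis by simp
    qed
    have h_leaf: "h z = leaf_image z" if "z \<in> tree_leaves" for z
      using gf[of "j z"] that j k by (simp add: spaces h_def f_def)
    have leaves: "(-1, 0) \<in> tree_leaves" "(0, 1) \<in> tree_leaves" "(sqrt 2, 0) \<in> tree_leaves"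
      "(sqrt 2 - 1, -1) \<in> tree_leaves" by (auto simp: tree_leaves_def)
    have "(5 + 4 * sqrt 2) / 7 \<le> K"
      using h_lip[of "(-1, 0)" "(0, 0)"] h_lip[of "(0, 1)" "(0, 0)"]
        h_lip[of "(sqrt 2, 0)" "(sqrt 2 - 1, 0)"] h_lip[of "(sqrt 2 - 1, -1)" "(sqrt 2 - 1, 0)"]
        h_lip[of "(0, 0)" "(sqrt 2 - 1, 0)"]
      by (intro leaf_image_extension_bound[of "h (0, 0)" K "h (sqrt 2 - 1, 0)"])
        (auto simp: h_leaf leaves l1_dist_def)
    then show "ereal ((5 + 4 * sqrt 2) / 7) \<le> e" by (simp add: e)
  qed
  also have "\<dots> \<le> nu TYPE('b) X Y" unfolding nu_def using B f by (intro Sup_upper) blast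
  also have "\<dots> \<le> ae_space TYPE('b) X" unfolding ae_space_def using sub by (intro Sup_upper) blast
  also have "\<dots> \<le> ae TYPE('a) TYPE('b) 4" unfolding ae_def using cardX by (intro Sup_upper) blast
  finally show ?thesis .
qed

theorem proposition1p6:
  assumes "(UNIV :: real set) \<lesssim> (UNIV :: 'a set)"
    and "(UNIV :: real set) \<lesssim> (UNIV :: 'b set)"
  shows "ereal ((5 + 4 * sqrt 2) / 7) \<le> ae TYPE('a) TYPE('b) 4 \<and>
         ae TYPE('a) TYPE('b) 4 \<le> ereal ((3 + 6 * sqrt 2) / 7)"
  using le_ae_4[OF assms] ae_4_le by blast

end
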